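(* Let $d,g\in\mathbb{N}$, let $\Omega\subseteq\mathbb{R}^d$ be measurable and bounded, and let $p\in(0,\infty]$. Then the sequence $(\mathcal{A}_n)_{n\in\mathbb{N}}$ of the sets $\mathcal{A}_n:=\mathcal{NN}_n(g,\mathbb{R}^d)$, considered as subsets of $L^p(\Omega)$ (by restricting functions to $\Omega$), is of controlled complexity in $L^p(\Omega)$.
   Context: Neural networks. Neural network weights are a tuple $\mathcal{W}=((A_1,b_1),\dots,(A_L,b_L))$ with $A_\ell\in\mathbb{R}^{N_\ell\times N_{\ell-1}}$, $b_\ell\in\mathbb{R}^{N_\ell}$, $L\in\mathbb{N}$, $N_0,\dots,N_L\in\mathbb{N}$. Put $d_{\mathrm{in}}(\mathcal{W})=N_0$, $d_{\mathrm{out}}(\mathcal{W})=N_L$, $L(\mathcal{W})=L$. With the ReLU $\varrho(x)=\max\{0,x\}$ acting componentwise and $T_\ell x=A_\ell x+b_\ell$, set $R_\varrho(\mathcal{W}):=T_L\circ(\varrho\circ T_{L-1})\circ\cdots\circ(\varrho\circ T_1):\mathbb{R}^{N_0}\to\mathbb{R}^{N_L}$. Let $\|A\|_{\ell^0}$ be the number of non-zero entries and $\|A\|_{\ell^\infty}$ the maximal absolute value of the entries of a matrix or vector. Put $\|\mathcal{W}\|_{\ell^0}=\sum_{j=1}^L(\|A_j\|_{\ell^0}+\|b_j\|_{\ell^0})$ and $\|\mathcal{W}\|_{\ell^\infty}=\max_{1\le j\le L}(\|A_j\|_{\ell^\infty}+\|b_j\|_{\ell^\infty})$. Then $\mathcal{NN}_n(g,\mathbb{R}^d)$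 is the set of all $R_\varrho(\mathcal{W})$ where $\mathcal{W}$ are neural network weights with $d_{\mathrm{in}}(\mathcal{W})=d$, $d_{\mathrm{out}}(\mathcal{W})=1$, $\|\mathcal{W}\|_{\ell^0}\le n$, $\|\mathcal{W}\|_{\ell^\infty}\le g\cdot n^g$ and $L(\mathcal{W})\le(\ln(en))^g$. Controlled complexity. Let $(\mathbb{X},d)$ be a quasi-metric space (metric axioms with $d(x,z)\le k(d(x,y)+d(y,z))$ for some $k\ge1$); here $\mathbb{X}=L^p(\Omega)$ with the (quasi-)metric induced by the (quasi-)norm. Write $B(x,R)=\{y:d(x,y)\le R\}$. For $\emptyset\ne S\subseteq\mathbb{X}$, $\mathcal{N}(S,\varepsilon)$ is the least $n\in\mathbb{N}$ such that $S$ is covered by $n$ closed balls of radius $\varepsilon$ with centers in $S$ ($\infty$ if there is none); $\mathcal{N}(\emptyset,\varepsilon)=0$. A family $(\mathcal{A}_n)_{n\in\mathbb{N}}$ of sets $\emptyset\ne\mathcal{A}_n\subseteq\mathbb{X}$ is of controlled complexity in $\mathbb{X}$ if for every $\alpha>0$, $x\in\mathbb{X}$ and $R>0$ there exist $n_0\in\mathbb{N}$ and $\eta:\mathbb{N}\to[0,\infty)$ such that $\sup_{n\in\mathbb{N}}\frac{\eta(n)}{n^{1+\delta}}<\infty$ for every $\delta>0$, and $\mathcal{N}\big(B(x,R)\cap\mathcal{A}_n,\,n^{-\alpha}\big)\le\exp(\eta(n))$ for all $n\ge n_0$. *)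

theory Defs
  imports
    "HOL-Analysis.Analysis"
    "HOL-Probability.Essential_Supremum"
    "Jordan_Normal_Form.Matrix"
begin

text \<open>The natural numbers of the source start at 1; this is the reason for the positivity
  conditions on widths and depths and for the restriction to indices \<open>n \<ge> 1\<close> below.\<close>

section \<open>ReLU networks\<close>

text \<open>Network weights with varying layer widths: the list of the pairs
  \<open>(A\<^sub>1, b\<^sub>1), \<dots>, (A\<^sub>L, b\<^sub>L)\<close>.\<close>

type_synonym weights = "(real mat \<times> real Matrix.vec) list"

definition nn_weights :: "weights \<Rightarrow> bool" where
  "nn_weights W \<longleftrightarrow> W \<noteq> [] \<and>
     (\<forall>(A, b) \<in> set W. dim_row A > 0 \<and> dim_col A > 0 \<and> dim_vec b = dim_row A) \<and>
     (\<forall>i. Suc i < length W \<longrightarrow> dim_col (fst (W ! Suc i)) = dim_row (fst (W ! i)))"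

definition d_in :: "weights \<Rightarrow> nat" where
  "d_in W = dim_col (fst (hd W))"

definition d_out :: "weights \<Rightarrow> nat" where
  "d_out W = dim_row (fst (last W))"

definition relu :: "real \<Rightarrow> real" where
  "relu x = max 0 x"

fun realization :: "weights \<Rightarrow> real Matrix.vec \<Rightarrow> real Matrix.vec" where
  "realization [] x = x"
| "realization [(A, b)] x = A *\<^sub>v x + b"
| "realization ((A, b) # W) x = realization W (map_vec relu (A *\<^sub>v x + b))"

definition mat_l0 :: "real mat \<Rightarrow> nat" where
  "mat_l0 A = card {(i, j). i < dim_row A \<and> j < dim_col A \<and> A $$ (i, j) \<noteq> 0}"

definition vec_l0 :: "real Matrix.vec \<Rightarrow> nat" where
  "vec_l0 b = card {i. i < dim_vec b \<and> vec_index b i \<noteq> 0}"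

definition mat_linf :: "real mat \<Rightarrow> real" where
  "mat_linf A = Max {\<bar>A $$ (i, j)\<bar> |i j. i < dim_row A \<and> j < dim_col A}"

definition vec_linf :: "real Matrix.vec \<Rightarrow> real" where
  "vec_linf b = Max {\<bar>vec_index b i\<bar> |i. i < dim_vec b}"

definition weights_l0 :: "weights \<Rightarrow> nat" where
  "weights_l0 W = (\<Sum>(A, b)\<leftarrow>W. mat_l0 A + vec_l0 b)"

definition weights_linf :: "weights \<Rightarrow> real" where
  "weights_linf W = Max ((\<lambda>(A, b). mat_linf A + vec_linf b) ` set W)"

text \<open>Points of \<open>\<real>\<^sup>d\<close> have type \<^typ>\<open>real ^ 'd\<close>; to feed them into a network, their coordinates
  are listed along a fixed bijection of \<open>{..<CARD('d)}\<close> with the index type. Another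
  bijection would only permute the columns of \<open>A\<^sub>1\<close>, so the set \<open>NN\<close> below does not depend
  on this choice.\<close>

definition coords :: "real ^ 'd::finite \<Rightarrow> real Matrix.vec" where
  "coords x = Matrix.vec CARD('d) (\<lambda>i. vec_nth x (from_nat_into (UNIV :: 'd set) i))"

definition NN :: "nat \<Rightarrow> nat \<Rightarrow> (real ^ 'd::finite \<Rightarrow> real) set" where
  "NN g n = {\<lambda>x. vec_index (realization W (coords x)) 0 |W.
     nn_weights W \<and> d_in W = CARD('d) \<and> d_out W = 1 \<and>
     weights_l0 W \<le> n \<and> weights_linf W \<le> real g * real n ^ g \<and>
     real (length W) \<le> ln (exp 1 * real n) ^ g}"

section \<open>Controlled complexity in quasi-metric spaces\<close>

locale quasi_metric_space =
  fixes X :: "'a set" and d :: "'a \<Rightarrow> 'a \<Rightarrow> real"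
  assumes nonneg: "x \<in> X \<Longrightarrow> y \<in> X \<Longrightarrow> 0 \<le> d x y"
    and zero_iff: "x \<in> X \<Longrightarrow> y \<in> X \<Longrightarrow> d x y = 0 \<longleftrightarrow> x = y"
    and sym: "x \<in> X \<Longrightarrow> y \<in> X \<Longrightarrow> d x y = d y x"
    and quasi_triangle:
      "\<exists>k\<ge>1. \<forall>x\<in>X. \<forall>y\<in>X. \<forall>z\<in>X. d x z \<le> k * (d x y + d y z)"
begin

definition qball :: "'a \<Rightarrow> real \<Rightarrow> 'a set" where
  "qball x R = {y \<in> X. d x y \<le> R}"

text \<open>The infimum over the empty set is \<open>\<infinity>\<close>, and the value at \<open>S = {}\<close> is \<open>0\<close>.\<close>

definition covering_number :: "'a set \<Rightarrow> real \<Rightarrow> enat" where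
  "covering_number S \<epsilon> =
     (INF n \<in> {n. \<exists>c :: nat \<Rightarrow> 'a. c ` {..<n} \<subseteq> S \<and> S \<subseteq> (\<Union>i<n. qball (c i) \<epsilon>)}. enat n)"

definition controlled_complexity :: "(nat \<Rightarrow> 'a set) \<Rightarrow> bool" where
  "controlled_complexity A \<longleftrightarrow>
     (\<forall>n\<ge>1. A n \<noteq> {} \<and> A n \<subseteq> X) \<and>
     (\<forall>\<alpha>>0. \<forall>x\<in>X. \<forall>R>0. \<exists>n\<^sub>0\<ge>1. \<exists>\<eta> :: nat \<Rightarrow> real.
        (\<forall>n\<ge>1. 0 \<le> \<eta> n) \<and>
        (\<forall>\<delta>>0. bdd_above ((\<lambda>n. \<eta> n / real n powr (1 + \<delta>)) ` {1..})) \<and>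
        (\<forall>n\<ge>n\<^sub>0. ereal_of_enat (covering_number (qball x R \<inter> A n) (real n powr (- \<alpha>)))
                    \<le> ereal (exp (\<eta> n))))"

end

section \<open>The spaces \<open>L\<^sup>p\<close> for \<open>0 < p \<le> \<infinity>\<close>\<close>

definition Lp_norm :: "ennreal \<Rightarrow> 'a measure \<Rightarrow> ('a \<Rightarrow> real) \<Rightarrow> real" where
  "Lp_norm p M f =
     (if p = \<infinity> then enn2real (esssup M (\<lambda>x. ennreal \<bar>f x\<bar>))
      else (\<integral>x. \<bar>f x\<bar> powr enn2real p \<partial>M) powr (1 / enn2real p))"

definition Lp_fun :: "ennreal \<Rightarrow> 'a measure \<Rightarrow> ('a \<Rightarrow> real) set" where
  "Lp_fun p M = {f \<in> borel_measurable M.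
     if p = \<infinity> then esssup M (\<lambda>x. ennreal \<bar>f x\<bar>) < \<infinity>
     else integrable M (\<lambda>x. \<bar>f x\<bar> powr enn2real p)}"

text \<open>Elements of \<open>L\<^sup>p\<close> are classes of almost everywhere equal functions. The values of a
  function outside \<^term>\<open>space M\<close> are irrelevant in all these notions, so that for
  \<open>M = lebesgue_on \<Omega>\<close> the map \<open>Lp_class p M\<close> includes the restriction of functions to \<open>\<Omega>\<close>.
  It sends a function outside of \<open>Lp_fun p M\<close> to the empty set, which is not in \<open>Lp_space p M\<close>.\<close>

definition Lp_class :: "ennreal \<Rightarrow> 'a measure \<Rightarrow> ('a \<Rightarrow> real) \<Rightarrow> ('a \<Rightarrow> real) set" where
  "Lp_class p M f = {h \<in> Lp_fun p M. f \<in> Lp_fun p M \<and> (AE x in M. f x = h x)}"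

definition Lp_space :: "ennreal \<Rightarrow> 'a measure \<Rightarrow> ('a \<Rightarrow> real) set set" where
  "Lp_space p M = Lp_class p M ` Lp_fun p M"

text \<open>The distance is computed with representatives; \<open>Lp_dist_class\<close> below shows that it does
  not depend on them.\<close>

definition Lp_dist :: "ennreal \<Rightarrow> 'a measure \<Rightarrow> ('a \<Rightarrow> real) set \<Rightarrow> ('a \<Rightarrow> real) set \<Rightarrow> real" where
  "Lp_dist p M F G = Lp_norm p M (\<lambda>x. (SOME f. f \<in> F) x - (SOME g. g \<in> G) x)"

lemma Lp_fun_measurable: "f \<in> Lp_fun p M \<Longrightarrow> f \<in> borel_measurable M"
  by (simp add: Lp_fun_def)

lemma Lp_norm_nonneg: "0 \<le> Lp_norm p M f"
  by (simp add: Lp_norm_def)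

lemma Lp_norm_cong_AE:
  assumes [measurable]: "f \<in> borel_measurable M" "g \<in> borel_measurable M"
    and ae: "AE x in M. f x = g x"
  shows "Lp_norm p M f = Lp_norm p M g"
proof -
  have "esssup M (\<lambda>x. ennreal \<bar>f x\<bar>) = esssup M (\<lambda>x. ennreal \<bar>g x\<bar>)"
    by (intro esssup_AE_cong) (use ae in auto)
  moreover have "(\<integral>x. \<bar>f x\<bar> powr enn2real p \<partial>M) = (\<integral>x. \<bar>g x\<bar> powr enn2real p \<partial>M)"
    by (intro integral_cong_AE) (use ae in auto)
  ultimately show ?thesis by (simp add: Lp_norm_def)
qed

lemma Lp_norm_minus_commute: "Lp_norm p M (\<lambda>x. f x - g x) = Lp_norm p M (\<lambda>x. g x - f x)"
  by (simp add: Lp_norm_def abs_minus_commute)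

lemma Lp_norm_eq_0_iff:
  assumes f: "f \<in> Lp_fun p M" and p: "p > 0"
  shows "Lp_norm p M f = 0 \<longleftrightarrow> (AE x in M. f x = 0)"
proof (cases "p = \<infinity>")
  case True
  have [measurable]: "f \<in> borel_measurable M" using f by (rule Lp_fun_measurable)
  let ?s = "esssup M (\<lambda>x. ennreal \<bar>f x\<bar>)"
  have "?s < \<infinity>" using f True by (simp add: Lp_fun_def)
  then have "Lp_norm p M f = 0 \<longleftrightarrow> ?s = 0"
    using True by (auto simp: Lp_norm_def enn2real_eq_0_iff)
  also have "\<dots> \<longleftrightarrow> (AE x in M. f x = 0)"
  proof
    assume "?s = 0"
    with esssup_AE[where M = M and f = "\<lambda>x. ennreal \<bar>f x\<bar>"] show "AE x in M. f x = 0"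
      by (auto elim!: eventually_mono)
  next
    assume "AE x in M. f x = 0"
    then have "?s \<le> 0" by (intro esssup_I) auto
    then show "?s = 0" by simp
  qed
  finally show ?thesis .
next
  case False
  have "integrable M (\<lambda>x. \<bar>f x\<bar> powr enn2real p)"
    using f False by (simp add: Lp_fun_def)
  then have "(\<integral>x. \<bar>f x\<bar> powr enn2real p \<partial>M) = 0 \<longleftrightarrow> (AE x in M. \<bar>f x\<bar> powr enn2real p = 0)"
    by (intro integral_nonneg_eq_0_iff_AE) auto
  then show ?thesis using False by (simp add: Lp_norm_def)
qed

lemma abs_add_powr_le:
  fixes a b q :: real
  assumes "q > 0" shows "\<bar>a + b\<bar> powr q \<le> 2 powr q * (\<bar>a\<bar> powr q + \<bar>b\<bar> powr q)"
proof -
  have "\<bar>a + b\<bar> powr q \<le> (2 * max \<bar>a\<bar> \<bar>b\<bar>) powr q"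
    using assms by (intro powr_mono2) auto
  also have "\<dots> = 2 powr q * max \<bar>a\<bar> \<bar>b\<bar> powr q" by (simp add: powr_mult)
  also have "\<dots> \<le> 2 powr q * (\<bar>a\<bar> powr q + \<bar>b\<bar> powr q)"
    by (intro mult_left_mono) (auto simp: max_def)
  finally show ?thesis .
qed

lemma Lp_add:
  assumes f: "f \<in> Lp_fun p M" and g: "g \<in> Lp_fun p M" and p: "p > 0"
  shows "(\<lambda>x. f x + g x) \<in> Lp_fun p M"
    and "Lp_norm p M (\<lambda>x. f x + g x)
           \<le> (2 * 2 powr (1 / enn2real p)) * (Lp_norm p M f + Lp_norm p M g)"
proof -
  have [measurable]: "f \<in> borel_measurable M" "g \<in> borel_measurable M"
    using f g by (auto intro: Lp_fun_measurable)
  have "(\<lambda>x. f x + g x) \<in> Lp_fun p M \<and> Lp_norm p M (\<lambda>x. f x + g x)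
           \<le> (2 * 2 powr (1 / enn2real p)) * (Lp_norm p M f + Lp_norm p M g)"
  proof (cases "p = \<infinity>")
    case True
    let ?s = "\<lambda>f. esssup M (\<lambda>x. ennreal \<bar>f x\<bar>)"
    have fin: "?s f < \<infinity>" "?s g < \<infinity>" using f g True by (auto simp: Lp_fun_def)
    have "AE x in M. ennreal \<bar>f x + g x\<bar> \<le> ?s f + ?s g"
      using esssup_AE[where M = M and f = "\<lambda>x. ennreal \<bar>f x\<bar>"]
        esssup_AE[where M = M and f = "\<lambda>x. ennreal \<bar>g x\<bar>"]
    proof eventually_elim
      case (elim x)
      have "ennreal \<bar>f x + g x\<bar> \<le> ennreal \<bar>f x\<bar> + ennreal \<bar>g x\<bar>"
        by (subst ennreal_plus[symmetric]) (auto intro!: ennreal_leI simp del: ennreal_plus)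
      also have "\<dots> \<le> ?s f + ?s g" using elim by (rule add_mono)
      finally show ?case .
    qed
    then have le: "?s (\<lambda>x. f x + g x) \<le> ?s f + ?s g" by (intro esssup_I) auto
    have lt: "?s f + ?s g < \<infinity>" using fin by (simp add: less_top)
    have "enn2real (?s (\<lambda>x. f x + g x)) \<le> enn2real (?s f + ?s g)"
      using le lt by (simp add: enn2real_mono)
    also have "\<dots> = enn2real (?s f) + enn2real (?s g)"
      using fin by (simp add: enn2real_plus)
    finally have "Lp_norm p M (\<lambda>x. f x + g x) \<le> Lp_norm p M f + Lp_norm p M g"
      using True by (simp add: Lp_norm_def)
    also have "\<dots> \<le> (2 * 2 powr (1 / enn2real p)) * (Lp_norm p M f + Lp_norm p M g)"
      using True Lp_norm_nonneg[of p M f] Lp_norm_nonneg[of p M g] by simp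
    finally show ?thesis using True le_less_trans[OF le lt] by (simp add: Lp_fun_def)
  next
    case False
    define q where "q = enn2real p"
    have q: "q > 0" using p False by (simp add: q_def enn2real_positive_iff less_top)
    let ?I = "\<lambda>f. \<integral>x. \<bar>f x\<bar> powr q \<partial>M"
    have int: "integrable M (\<lambda>x. \<bar>f x\<bar> powr q)" "integrable M (\<lambda>x. \<bar>g x\<bar> powr q)"
      using f g False by (auto simp: Lp_fun_def q_def)
    have int': "integrable M (\<lambda>x. 2 powr q * (\<bar>f x\<bar> powr q + \<bar>g x\<bar> powr q))"
      using int by simp
    have intfg: "integrable M (\<lambda>x. \<bar>f x + g x\<bar> powr q)"
      by (rule Bochner_Integration.integrable_bound[OF int'])
         (use abs_add_powr_le[OF q] in \<open>auto intro!: AE_I2\<close>)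
    have "?I (\<lambda>x. f x + g x) \<le> (\<integral>x. 2 powr q * (\<bar>f x\<bar> powr q + \<bar>g x\<bar> powr q) \<partial>M)"
      using intfg int' abs_add_powr_le[OF q] by (intro integral_mono)
    also have "\<dots> = 2 powr q * (?I f + ?I g)" using int by simp
    finally have "?I (\<lambda>x. f x + g x) powr (1 / q) \<le> (2 powr q * (?I f + ?I g)) powr (1 / q)"
      using q by (intro powr_mono2) auto
    also have "\<dots> = 2 * (?I f + ?I g) powr (1 / q)"
      using q by (simp add: powr_mult powr_powr)
    also have "\<dots> \<le> 2 * (2 powr (1 / q) * (?I f powr (1 / q) + ?I g powr (1 / q)))"
      using abs_add_powr_le[of "1 / q" "?I f" "?I g"] q by simp
    finally have "Lp_norm p M (\<lambda>x. f x + g x)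
        \<le> (2 * 2 powr (1 / enn2real p)) * (Lp_norm p M f + Lp_norm p M g)"
      using False by (simp add: Lp_norm_def q_def)
    then show ?thesis using False intfg by (simp add: Lp_fun_def q_def)
  qed
  then show "(\<lambda>x. f x + g x) \<in> Lp_fun p M"
    and "Lp_norm p M (\<lambda>x. f x + g x)
           \<le> (2 * 2 powr (1 / enn2real p)) * (Lp_norm p M f + Lp_norm p M g)"
    by auto
qed

lemma Lp_diff:
  assumes "f \<in> Lp_fun p M" "g \<in> Lp_fun p M" "p > 0"
  shows "(\<lambda>x. f x - g x) \<in> Lp_fun p M"
proof -
  have "(\<lambda>x. - g x) \<in> Lp_fun p M" using assms(2) by (auto simp: Lp_fun_def)
  from Lp_add(1)[OF assms(1) this assms(3)] show ?thesis by simp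
qed

lemma Lp_class_self: "f \<in> Lp_fun p M \<Longrightarrow> f \<in> Lp_class p M f"
  by (simp add: Lp_class_def)

lemma Lp_class_eq_iff:
  assumes "f \<in> Lp_fun p M" "g \<in> Lp_fun p M"
  shows "Lp_class p M f = Lp_class p M g \<longleftrightarrow> (AE x in M. f x = g x)"
proof
  assume "Lp_class p M f = Lp_class p M g"
  with Lp_class_self[OF assms(2)] have "g \<in> Lp_class p M f" by simp
  then show "AE x in M. f x = g x" by (simp add: Lp_class_def)
next
  assume ae: "AE x in M. f x = g x"
  have "(AE x in M. f x = h x) \<longleftrightarrow> (AE x in M. g x = h x)" for h
    by (rule eventually_subst) (use ae in \<open>auto elim!: eventually_mono\<close>)
  with assms show "Lp_class p M f = Lp_class p M g" by (simp add: Lp_class_def)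
qed

lemma Lp_dist_class:
  assumes "f \<in> Lp_fun p M" "g \<in> Lp_fun p M"
  shows "Lp_dist p M (Lp_class p M f) (Lp_class p M g) = Lp_norm p M (\<lambda>x. f x - g x)"
proof -
  define f' where "f' = (SOME h. h \<in> Lp_class p M f)"
  define g' where "g' = (SOME h. h \<in> Lp_class p M g)"
  have "f' \<in> Lp_class p M f" "g' \<in> Lp_class p M g"
    unfolding f'_def g'_def
    using Lp_class_self[OF assms(1)] Lp_class_self[OF assms(2)]
    by (simp_all add: some_in_eq) auto
  then have fg: "f' \<in> Lp_fun p M" "g' \<in> Lp_fun p M"
    and ae: "AE x in M. f x = f' x" "AE x in M. g x = g' x"
    by (auto simp: Lp_class_def)
  have [measurable]: "f \<in> borel_measurable M" "g \<in> borel_measurable M"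
    "f' \<in> borel_measurable M" "g' \<in> borel_measurable M"
    using assms fg by (auto intro: Lp_fun_measurable)
  have "Lp_norm p M (\<lambda>x. f' x - g' x) = Lp_norm p M (\<lambda>x. f x - g x)"
    by (intro Lp_norm_cong_AE) (use ae in auto)
  then show ?thesis by (simp add: Lp_dist_def f'_def g'_def)
qed

lemma quasi_metric_space_Lp:
  assumes p: "p > 0"
  shows "quasi_metric_space (Lp_space p M) (Lp_dist p M)"
proof
  show "\<exists>k\<ge>1. \<forall>x\<in>Lp_space p M. \<forall>y\<in>Lp_space p M. \<forall>z\<in>Lp_space p M.
    Lp_dist p M x z \<le> k * (Lp_dist p M x y + Lp_dist p M y z)"
  proof (intro exI[of _ "2 * 2 powr (1 / enn2real p)"] conjI ballI)
    have "(1::real) \<le> 2 powr (1 / enn2real p)" by (rule ge_one_powr_ge_zero) auto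
    then show "1 \<le> 2 * (2::real) powr (1 / enn2real p)" by simp
  next
    fix x y z assume "x \<in> Lp_space p M" "y \<in> Lp_space p M" "z \<in> Lp_space p M"
    then obtain f g h where fgh: "f \<in> Lp_fun p M" "g \<in> Lp_fun p M" "h \<in> Lp_fun p M"
      "x = Lp_class p M f" "y = Lp_class p M g" "z = Lp_class p M h"
      by (auto simp: Lp_space_def)
    from Lp_add(2)[OF Lp_diff[OF fgh(1,2) p] Lp_diff[OF fgh(2,3) p] p]
    show "Lp_dist p M x z \<le> 2 * 2 powr (1 / enn2real p) * (Lp_dist p M x y + Lp_dist p M y z)"
      using fgh by (simp add: Lp_dist_class)
  qed
next
  fix x y assume "x \<in> Lp_space p M" "y \<in> Lp_space p M"
  then obtain f g where fg: "f \<in> Lp_fun p M" "g \<in> Lp_fun p M"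
    "x = Lp_class p M f" "y = Lp_class p M g"
    by (auto simp: Lp_space_def)
  show "Lp_dist p M x y = 0 \<longleftrightarrow> x = y"
    using fg Lp_norm_eq_0_iff[OF Lp_diff[OF fg(1,2) p] p]
    by (simp add: Lp_dist_class Lp_class_eq_iff)
  show "Lp_dist p M x y = Lp_dist p M y x"
    using fg Lp_norm_minus_commute[of p M f g] by (simp add: Lp_dist_class)
qed (simp add: Lp_dist_def Lp_norm_nonneg)

end

theory Submission
  imports Defs "HOL-Real_Asymp.Real_Asymp"
begin

text \<open>A hidden neuron whose row of weights and bias vanish contributes nothing, so a network with
  at most \<open>n\<close> non-zero weights can be rewritten with all layers of one common width
  \<open>N = n + d\<close>. For inputs bounded by \<open>Y\<close>, changing each weight by at most \<open>\<delta>\<close> changes the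
  output by at most \<open>L \<delta> Y ((N + 1) B)\<^sup>L\<close>, where \<open>B = g n\<^sup>g\<close> bounds the weights. As the depth \<open>L\<close>
  is polylogarithmic in \<open>n\<close>, a mesh \<open>\<delta>\<close> with \<open>ln (1 / \<delta>)\<close> polylogarithmic suffices for the
  accuracy \<open>n powr (- \<alpha>)\<close>. Rounding the weights leaves at most \<open>n\<close> non-zero entries, hence
  \<open>exp (c n (ln (e n)) ^ (g + 1))\<close> rounded networks. Picking one member of the set from each
  class of equally rounded networks yields centers inside the set.\<close>

section \<open>Networks of uniform width\<close>

text \<open>All layers have width \<open>N\<close>; the bias is stored in column \<open>N\<close> of the weight matrix.\<close>

definition layer :: "nat \<Rightarrow> (nat \<Rightarrow> nat \<Rightarrow> real) \<Rightarrow> (nat \<Rightarrow> real) \<Rightarrow> nat \<Rightarrow> real" where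
  "layer N M z i = (\<Sum>j<N. M i j * z j) + M i N"

fun eval_net :: "nat \<Rightarrow> (nat \<Rightarrow> nat \<Rightarrow> real) list \<Rightarrow> (nat \<Rightarrow> real) \<Rightarrow> real" where
  "eval_net N [] z = 0"
| "eval_net N [M] z = layer N M z 0"
| "eval_net N (M # V) z = eval_net N V (\<lambda>i. relu (layer N M z i))"

definition supp :: "(nat \<Rightarrow> nat \<Rightarrow> real) \<Rightarrow> (nat \<times> nat) set" where
  "supp M = {(i, j). M i j \<noteq> 0}"

text \<open>Matrices are functions on all index pairs, so that two networks can be compared entry by
  entry whatever their original widths. Columns run up to and including \<open>N\<close>, because
  column \<open>N\<close> holds the bias.\<close>

definition sparse_nets :: "nat \<Rightarrow> real \<Rightarrow> nat \<Rightarrow> nat \<Rightarrow> (nat \<Rightarrow> nat \<Rightarrow> real) list set" where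
  "sparse_nets N B K n =
     {V. V \<noteq> [] \<and> length V \<le> K \<and> (\<Sum>M\<leftarrow>V. card (supp M)) \<le> n \<and>
         (\<forall>M\<in>set V. supp M \<subseteq> {..<N} \<times> {..N} \<and> (\<forall>i j. \<bar>M i j\<bar> \<le> B))}"

section \<open>Restriction of a network to its active neurons\<close>

lemma finite_mat_support:
  "finite {(i, j). i < dim_row A \<and> j < dim_col A \<and> A $$ (i, j) \<noteq> (0::real)}"
  by (rule finite_subset[of _ "{..<dim_row A} \<times> {..<dim_col A}"]) auto

lemma finite_vec_support: "finite {i. i < dim_vec b \<and> vec_index b i \<noteq> (0::real)}"
  by (rule finite_subset[of _ "{..<dim_vec b}"]) auto

text \<open>The enumerations \<open>e\<close> and \<open>e'\<close> list the active neurons of the previous and of the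
  present layer, of which there are \<open>m\<close> and \<open>m'\<close>.\<close>

definition compress ::
  "nat \<Rightarrow> nat \<Rightarrow> (nat \<Rightarrow> nat) \<Rightarrow> nat \<Rightarrow> (nat \<Rightarrow> nat) \<Rightarrow> real mat \<Rightarrow> real Matrix.vec
    \<Rightarrow> nat \<Rightarrow> nat \<Rightarrow> real" where
  "compress N m e m' e' A b i j =
     (if i < m' \<and> j < m then A $$ (e' i, e j)
      else if i < m' \<and> j = N then vec_index b (e' i) else 0)"

context
  fixes N m m' :: nat and e e' :: "nat \<Rightarrow> nat" and A :: "real mat" and b :: "real Matrix.vec"
  assumes m: "m \<le> N" "m' \<le> N"
    and e: "inj_on e {..<m}" "e ` {..<m} \<subseteq> {..<dim_col A}"
    and e': "inj_on e' {..<m'}" "e' ` {..<m'} \<subseteq> {..<dim_row A}"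
    and dim: "dim_vec b = dim_row A"
begin

lemma supp_compress_subset: "supp (compress N m e m' e' A b) \<subseteq> {..<N} \<times> {..N}"
  using m by (auto simp: supp_def compress_def split: if_splits)

text \<open>As \<open>e\<close> and \<open>e'\<close> are injective, distinct non-zero entries of
  the compressed matrix come from distinct non-zero entries of \<open>A\<close> or \<open>b\<close>.
  So compression never increases the number of non-zero weights.\<close>

lemma card_supp_compress: "card (supp (compress N m e m' e' A b)) \<le> mat_l0 A + vec_l0 b"
proof -
  let ?S = "{(i, j). i < m' \<and> j < m \<and> A $$ (e' i, e j) \<noteq> 0}"
  let ?T = "{i. i < m' \<and> vec_index b (e' i) \<noteq> 0}"
  have fin: "finite ?S" "finite ?T"
    by (rule finite_subset[of _ "{..<m'} \<times> {..<m}"]) auto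
  have "supp (compress N m e m' e' A b) \<subseteq> ?S \<union> (\<lambda>i. (i, N)) ` ?T"
    using m by (auto simp: supp_def compress_def split: if_splits)
  then have "card (supp (compress N m e m' e' A b)) \<le> card (?S \<union> (\<lambda>i. (i, N)) ` ?T)"
    by (rule card_mono[rotated]) (use fin in auto)
  also have "\<dots> \<le> card ?S + card ((\<lambda>i. (i, N)) ` ?T)" by (rule card_Un_le)
  also have "card ((\<lambda>i. (i, N)) ` ?T) \<le> card ?T" by (rule card_image_le[OF fin(2)])
  also have "card ?T \<le> vec_l0 b" unfolding vec_l0_def
    by (rule card_inj_on_le[of e', OF _ _ finite_vec_support])
      (use e' dim in \<open>auto simp: inj_on_def\<close>)
  also have "card ?S \<le> mat_l0 A" unfolding mat_l0_def
    by (rule card_inj_on_le[of "\<lambda>(i, j). (e' i, e j)", OF _ _ finite_mat_support])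
      (use e e' in \<open>auto simp: inj_on_def\<close>)
  finally show ?thesis by simp
qed

text \<open>The dropped columns of \<open>A\<close> meet only vanishing coordinates of
  \<open>x\<close>, so no contribution is lost. The values of \<open>z\<close> from \<open>m\<close>
  on may be arbitrary: columns \<open>m\<close> to \<open>N - 1\<close> of the compressed matrix are
  zero.\<close>

lemma layer_compress:
  assumes x: "dim_vec x = dim_col A"
    and supp: "\<And>i. i < dim_col A \<Longrightarrow> i \<notin> e ` {..<m} \<Longrightarrow> vec_index x i = 0"
    and z: "\<And>i. i < m \<Longrightarrow> z i = vec_index x (e i)"
    and i: "i < m'"
  shows "layer N (compress N m e m' e' A b) z i = vec_index (A *\<^sub>v x + b) (e' i)"
proof -
  have ei: "e' i < dim_row A" using e'(2) i by auto
  have "(\<Sum>j<N. compress N m e m' e' A b i j * z j) = (\<Sum>j<m. A $$ (e' i, e j) * vec_index x (e j))"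
    by (rule sum.mono_neutral_cong_right) (use m i z in \<open>auto simp: compress_def\<close>)
  also have "\<dots> = (\<Sum>k\<in>e ` {..<m}. A $$ (e' i, k) * vec_index x k)"
    by (simp add: sum.reindex[OF e(1)])
  also have "\<dots> = (\<Sum>k\<in>{0..<dim_col A}. A $$ (e' i, k) * vec_index x k)"
    by (rule sum.mono_neutral_left) (use e supp in auto)
  also have "\<dots> = vec_index (A *\<^sub>v x) (e' i)"
    using ei x by (simp add: scalar_prod_def)
  finally show ?thesis
    using ei i m dim by (simp add: layer_def compress_def)
qed

end

lemma abs_compress_le:
  assumes "0 \<le> B"
    and "\<And>i j. i < dim_row A \<Longrightarrow> j < dim_col A \<Longrightarrow> \<bar>A $$ (i, j)\<bar> \<le> B"
    and "\<And>i. i < dim_vec b \<Longrightarrow> \<bar>vec_index b i\<bar> \<le> B"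
    and "e ` {..<m} \<subseteq> {..<dim_col A}" "e' ` {..<m'} \<subseteq> {..<dim_row A}"
    and "dim_vec b = dim_row A"
  shows "\<bar>compress N m e m' e' A b i j\<bar> \<le> B"
proof -
  have "e' i < dim_row A" if "i < m'" using assms(5) that by auto
  moreover have "e j < dim_col A" if "j < m" using assms(4) that by auto
  ultimately show ?thesis using assms(1,2,3,6) by (simp add: compress_def)
qed

text \<open>A neuron is active if its row of \<open>A\<close> or its bias is non-zero. Each active
  neuron owns at least one non-zero weight, which bounds their number; an inactive one computes 0
  from every input.\<close>

lemma ex_active_neurons:
  fixes A :: "real mat" and b :: "real Matrix.vec"
  assumes dim: "dim_vec b = dim_row A"
  obtains m e where "inj_on e {..<m}" "e ` {..<m} \<subseteq> {..<dim_row A}"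
    "m \<le> mat_l0 A + vec_l0 b"
    "\<And>x i. dim_vec x = dim_col A \<Longrightarrow> i < dim_row A \<Longrightarrow> i \<notin> e ` {..<m} \<Longrightarrow>
       vec_index (A *\<^sub>v x + b) i = 0"
proof -
  let ?SA = "{(i, j). i < dim_row A \<and> j < dim_col A \<and> A $$ (i, j) \<noteq> 0}"
  let ?Sb = "{i. i < dim_vec b \<and> vec_index b i \<noteq> 0}"
  let ?S = "fst ` ?SA \<union> ?Sb"
  have fin: "finite ?S"
    using finite_mat_support[of A] finite_vec_support[of b] by blast
  then obtain e where e: "bij_betw e {..<card ?S} ?S"
    using ex_bij_betw_nat_finite[OF fin] by (auto simp: atLeast0LessThan)
  show thesis
  proof (rule that[of e "card ?S"])
    show "inj_on e {..<card ?S}" using e by (rule bij_betw_imp_inj_on)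
    show "e ` {..<card ?S} \<subseteq> {..<dim_row A}"
      using bij_betw_imp_surj_on[OF e] dim by auto
    have "card ?S \<le> card (fst ` ?SA) + card ?Sb" by (rule card_Un_le)
    also have "card (fst ` ?SA) \<le> card ?SA" by (rule card_image_le[OF finite_mat_support])
    finally show "card ?S \<le> mat_l0 A + vec_l0 b" by (simp add: mat_l0_def vec_l0_def)
  next
    fix x :: "real Matrix.vec" and i
    assume x: "dim_vec x = dim_col A" and i: "i < dim_row A" "i \<notin> e ` {..<card ?S}"
    then have iS: "i \<notin> ?S" using bij_betw_imp_surj_on[OF e] by simp
    have "A $$ (i, j) = 0" if "j < dim_col A" for j
    proof (rule ccontr)
      assume "A $$ (i, j) \<noteq> 0"
      then have "(i, j) \<in> ?SA" using that i by auto
      then have "i \<in> fst ` ?SA" by force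
      then show False using iS by blast
    qed
    moreover have "vec_index b i = 0" using iS i dim by auto
    ultimately show "vec_index (A *\<^sub>v x + b) i = 0"
      using i dim x by (simp add: scalar_prod_def)
  qed
qed

lemma nn_weights_Cons_Cons:
  "nn_weights ((A, b) # (A', b') # W) \<longleftrightarrow>
     dim_row A > 0 \<and> dim_col A > 0 \<and> dim_vec b = dim_row A \<and> dim_col A' = dim_row A \<and>
     nn_weights ((A', b') # W)"
proof -
  have *: "(\<forall>i. P i) \<longleftrightarrow> P 0 \<and> (\<forall>i. P (Suc i))" for P :: "nat \<Rightarrow> bool"
    by (metis not0_implies_Suc)
  show ?thesis unfolding nn_weights_def by (subst *) auto
qed

text \<open>Induction from the input side, carrying the enumeration \<open>e\<close> of the neurons
  through which the input enters. The invariant is that \<open>x\<close> vanishes at all other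
  neurons and that \<open>z\<close> lists the values at the enumerated ones; every layer passes it
  on.\<close>

lemma ex_compressed_net:
  assumes "nn_weights W" "d_out W = 1"
    and "N \<ge> 1" "m \<le> N" "inj_on e {..<m}" "e ` {..<m} \<subseteq> {..<d_in W}"
    and "weights_l0 W \<le> N" "0 \<le> B"
    and "\<And>A b i j. (A, b) \<in> set W \<Longrightarrow> i < dim_row A \<Longrightarrow> j < dim_col A \<Longrightarrow> \<bar>A $$ (i, j)\<bar> \<le> B"
    and "\<And>A b i. (A, b) \<in> set W \<Longrightarrow> i < dim_vec b \<Longrightarrow> \<bar>vec_index b i\<bar> \<le> B"
  shows "\<exists>V \<in> sparse_nets N B (length W) (weights_l0 W).
    \<forall>x z. dim_vec x = d_in W \<longrightarrow> (\<forall>i<d_in W. i \<notin> e ` {..<m} \<longrightarrow> vec_index x i = 0) \<longrightarrow>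
      (\<forall>i<m. z i = vec_index x (e i)) \<longrightarrow> vec_index (realization W x) 0 = eval_net N V z"
  using assms
proof (induction W arbitrary: m e)
  case Nil
  then show ?case by (simp add: nn_weights_def)
next
  case (Cons Ab W)
  obtain A b where [simp]: "Ab = (A, b)" by (cases Ab)
  have dims: "dim_vec b = dim_row A" using Cons.prems(1) by (auto simp: nn_weights_def)
  have bdA: "\<bar>A $$ (i, j)\<bar> \<le> B" if "i < dim_row A" "j < dim_col A" for i j
    using Cons.prems(9)[of A b i j] that by simp
  have bdb: "\<bar>vec_index b i\<bar> \<le> B" if "i < dim_vec b" for i
    using Cons.prems(10)[of A b i] that by simp
  have eA: "e ` {..<m} \<subseteq> {..<dim_col A}" using Cons.prems(6) by (simp add: d_in_def)
  show ?case
  proof (cases W)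
    case Nil
    have row: "dim_row A = 1" using Cons.prems(2) Nil by (simp add: d_out_def)
    \<comment> \<open>The output neuron is kept as neuron 0 even if it is inactive, so the last
      layer takes \<open>m' = 1\<close>, which fits because \<open>N\<close> is at least 1.\<close>
    have e': "inj_on id {..<1::nat}" "id ` {..<1} \<subseteq> {..<dim_row A}" using row by auto
    let ?M = "compress N m e 1 id A b"
    note c = Cons.prems(4,3,5) eA e' dims
    have "[?M] \<in> sparse_nets N B (length (Ab # W)) (weights_l0 (Ab # W))"
      using supp_compress_subset[OF c] card_supp_compress[OF c]
        abs_compress_le[OF Cons.prems(8) bdA bdb eA e'(2) dims] Nil
      by (auto simp: sparse_nets_def weights_l0_def)
    moreover have "vec_index (realization (Ab # W) x) 0 = eval_net N [?M] z"
      if "dim_vec x = d_in (Ab # W)" "\<forall>i<d_in (Ab # W). i \<notin> e ` {..<m} \<longrightarrow> vec_index x i = 0"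
        "\<forall>i<m. z i = vec_index x (e i)" for x z
      using layer_compress[OF c, of x z 0] that Nil by (simp add: d_in_def)
    ultimately show ?thesis by blast
  next
    case (Cons Ab' W')
    obtain A' b' where Ab': "Ab' = (A', b')" by (cases Ab')
    have W: "nn_weights W" "dim_col A' = dim_row A"
      using Cons.prems(1) by (auto simp: Cons Ab' nn_weights_Cons_Cons)
    have din: "d_in W = dim_row A" using W(2) by (simp add: Cons Ab' d_in_def)
    have l0: "weights_l0 (Ab # W) = mat_l0 A + vec_l0 b + weights_l0 W"
      by (simp add: weights_l0_def)
    obtain m' e' where e': "inj_on e' {..<m'}" "e' ` {..<m'} \<subseteq> {..<dim_row A}"
      and m': "m' \<le> mat_l0 A + vec_l0 b"
      and inactive: "\<And>x i. dim_vec x = dim_col A \<Longrightarrow> i < dim_row A \<Longrightarrow> i \<notin> e' ` {..<m'} \<Longrightarrow>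
         vec_index (A *\<^sub>v x + b) i = 0"
      using ex_active_neurons[OF dims] by metis
    \<comment> \<open>The active neurons of one layer are at most as many as its non-zero weights,
      and the whole network has at most \<open>N\<close> of these.\<close>
    have m'N: "m' \<le> N" using m' l0 Cons.prems(7) by simp
    have "\<exists>V \<in> sparse_nets N B (length W) (weights_l0 W).
      \<forall>x z. dim_vec x = d_in W \<longrightarrow> (\<forall>i<d_in W. i \<notin> e' ` {..<m'} \<longrightarrow> vec_index x i = 0) \<longrightarrow>
        (\<forall>i<m'. z i = vec_index x (e' i)) \<longrightarrow> vec_index (realization W x) 0 = eval_net N V z"
    proof (rule Cons.IH[OF W(1) _ Cons.prems(3) m'N e'(1) _ _ Cons.prems(8)])
      show "d_out W = 1" using Cons.prems(2) by (simp add: Cons d_out_def)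
      show "e' ` {..<m'} \<subseteq> {..<d_in W}" using e'(2) din by simp
      show "weights_l0 W \<le> N" using Cons.prems(7) l0 by simp
      show "\<bar>A $$ (i, j)\<bar> \<le> B" if "(A, b) \<in> set W" "i < dim_row A" "j < dim_col A" for A b i j
        using Cons.prems(9)[of A b] that by simp
      show "\<bar>vec_index b i\<bar> \<le> B" if "(A, b) \<in> set W" "i < dim_vec b" for A b i
        using Cons.prems(10)[of A b] that by simp
    qed
    then obtain V where V: "V \<in> sparse_nets N B (length W) (weights_l0 W)"
      and eq: "\<And>x z. dim_vec x = d_in W \<Longrightarrow>
        (\<forall>i<d_in W. i \<notin> e' ` {..<m'} \<longrightarrow> vec_index x i = 0) \<Longrightarrow>
        (\<forall>i<m'. z i = vec_index x (e' i)) \<Longrightarrow> vec_index (realization W x) 0 = eval_net N V z"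
      by blast
    let ?M = "compress N m e m' e' A b"
    note c = Cons.prems(4) m'N Cons.prems(5) eA e' dims
    have "?M # V \<in> sparse_nets N B (length (Ab # W)) (weights_l0 (Ab # W))"
      using V supp_compress_subset[OF c] card_supp_compress[OF c] l0
        abs_compress_le[OF Cons.prems(8) bdA bdb eA e'(2) dims]
      by (auto simp: sparse_nets_def)
    moreover have "vec_index (realization (Ab # W) x) 0 = eval_net N (?M # V) z"
      if x: "dim_vec x = d_in (Ab # W)" "\<forall>i<d_in (Ab # W). i \<notin> e ` {..<m} \<longrightarrow> vec_index x i = 0"
        "\<forall>i<m. z i = vec_index x (e i)" for x z
    proof -
      have xA: "dim_vec x = dim_col A" using x(1) by (simp add: d_in_def)
      have "vec_index (realization W (map_vec relu (A *\<^sub>v x + b))) 0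
          = eval_net N V (\<lambda>i. relu (layer N ?M z i))"
      proof (rule eq)
        show "dim_vec (map_vec relu (A *\<^sub>v x + b)) = d_in W" using dims din by simp
        \<comment> \<open>Inactive neurons have value 0 before the activation, and ReLU fixes 0;
          this restores the invariant for the next layer.\<close>
        show "\<forall>i<d_in W. i \<notin> e' ` {..<m'} \<longrightarrow> vec_index (map_vec relu (A *\<^sub>v x + b)) i = 0"
          using inactive[OF xA] dims din by (simp add: relu_def)
        show "\<forall>i<m'. relu (layer N ?M z i) = vec_index (map_vec relu (A *\<^sub>v x + b)) (e' i)"
        proof (intro allI impI)
          fix i assume i: "i < m'"
          have "layer N ?M z i = vec_index (A *\<^sub>v x + b) (e' i)"
            by (rule layer_compress[OF c xA _ _ i]) (use x in \<open>auto simp: d_in_def\<close>)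
          moreover have "e' i < dim_row A" using e'(2) i by auto
          ultimately show "relu (layer N ?M z i) = vec_index (map_vec relu (A *\<^sub>v x + b)) (e' i)"
            using dims by simp
        qed
      qed
      \<comment> \<open>For a non-empty tail, \<open>eval_net\<close> applies ReLU after the first
        layer, as \<open>realization\<close> does.\<close>
      moreover have "V \<noteq> []" using V by (simp add: sparse_nets_def)
      ultimately show ?thesis by (cases V) (simp_all add: Cons)
    qed
    ultimately show ?thesis by blast
  qed
qed

section \<open>Dependence of the output on the weights\<close>

lemma abs_relu_diff_le: "\<bar>relu x - relu y\<bar> \<le> \<bar>x - y\<bar>"
  by (simp add: relu_def)

lemma abs_relu_le: "\<bar>relu x\<bar> \<le> \<bar>x\<bar>"
  by (simp add: relu_def)

text \<open>The bias acts as the weight of one more input with value 1. Since 1 \<le>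
  \<open>Y\<close>, there are \<open>N + 1\<close> summands, each at most
  \<open>B * Y\<close>.\<close>

lemma abs_layer_le:
  assumes M: "\<And>i j. \<bar>M i j\<bar> \<le> B" and z: "\<And>i. \<bar>z i\<bar> \<le> Y" and Y: "1 \<le> Y"
  shows "\<bar>layer N M z i\<bar> \<le> (real N + 1) * B * Y"
proof -
  have B: "0 \<le> B" using M[of 0 0] by linarith
  have "\<bar>\<Sum>j<N. M i j * z j\<bar> \<le> (\<Sum>j<N. \<bar>M i j * z j\<bar>)" by (rule sum_abs)
  also have "\<dots> \<le> (\<Sum>j<N. B * Y)"
    using M z B by (intro sum_mono) (auto simp: abs_mult intro!: mult_mono)
  finally have "\<bar>\<Sum>j<N. M i j * z j\<bar> \<le> real N * (B * Y)" by simp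
  moreover have "\<bar>M i N\<bar> \<le> B * Y" using M[of i N] mult_left_mono[OF Y B] by simp
  ultimately show ?thesis unfolding layer_def by (simp add: algebra_simps)
qed

text \<open>Split M z - M' z' = M (z - z') + (M - M') z' in each of the \<open>N\<close> products;
  the bias satisfies the same bound because 1 \<le> \<open>Y\<close>.\<close>

lemma abs_layer_diff_le:
  assumes M: "\<And>i j. \<bar>M i j\<bar> \<le> B" and diff: "\<And>i j. \<bar>M i j - M' i j\<bar> \<le> \<delta>"
    and z': "\<And>i. \<bar>z' i\<bar> \<le> Y" and Y: "1 \<le> Y" and zz': "\<And>i. \<bar>z i - z' i\<bar> \<le> t"
  shows "\<bar>layer N M z i - layer N M' z' i\<bar> \<le> (real N + 1) * (B * t + \<delta> * Y)"
proof -
  have B: "0 \<le> B" using M[of 0 0] by linarith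
  have \<delta>: "0 \<le> \<delta>" using diff[of 0 0] by linarith
  have t: "0 \<le> t" using zz'[of 0] by linarith
  have "\<bar>M i j * z j - M' i j * z' j\<bar> \<le> B * t + \<delta> * Y" for j
  proof -
    have "M i j * z j - M' i j * z' j = M i j * (z j - z' j) + (M i j - M' i j) * z' j"
      by (simp add: algebra_simps)
    also have "\<bar>\<dots>\<bar> \<le> \<bar>M i j\<bar> * \<bar>z j - z' j\<bar> + \<bar>M i j - M' i j\<bar> * \<bar>z' j\<bar>"
      by (simp add: abs_mult[symmetric])
    also have "\<dots> \<le> B * t + \<delta> * Y"
      using M diff z' zz' B \<delta> by (intro add_mono mult_mono) auto
    finally show ?thesis .
  qed
  then have "\<bar>\<Sum>j<N. M i j * z j - M' i j * z' j\<bar> \<le> (\<Sum>j<N. B * t + \<delta> * Y)"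
    by (rule order_trans[OF sum_abs sum_mono])
  moreover have "\<bar>M i N - M' i N\<bar> \<le> B * t + \<delta> * Y"
    using diff[of i N] mult_left_mono[OF Y \<delta>] mult_nonneg_nonneg[OF B t] by simp
  moreover have "layer N M z i - layer N M' z' i
      = (\<Sum>j<N. M i j * z j - M' i j * z' j) + (M i N - M' i N)"
    by (simp add: layer_def sum_subtractf)
  ultimately show ?thesis by (simp add: algebra_simps)
qed

text \<open>With q = (N + 1) B, one layer turns the pair (Y, t) into (q Y, q (t + \<delta> Y)). The
  bound reproduces itself: q^(L-1) (q (t + \<delta> Y) + (L-1) \<delta> q Y) = q^L (t + L \<delta>
  Y). Allowing different inputs, with distance \<open>t\<close>, also makes the lemma yield
  boundedness of a single network.\<close>

lemma abs_eval_net_diff_le: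
  fixes B Y \<delta> t :: real
  assumes "length V = length V'"
    and "\<And>M i j. M \<in> set V \<union> set V' \<Longrightarrow> \<bar>M i j\<bar> \<le> B"
    and "\<And>l i j. l < length V \<Longrightarrow> \<bar>(V ! l) i j - (V' ! l) i j\<bar> \<le> \<delta>"
    and "1 \<le> B" "1 \<le> Y" "0 \<le> \<delta>" and "\<And>i. \<bar>z' i\<bar> \<le> Y" and "\<And>i. \<bar>z i - z' i\<bar> \<le> t"
  shows "\<bar>eval_net N V z - eval_net N V' z'\<bar>
    \<le> ((real N + 1) * B) ^ length V * (t + length V * \<delta> * Y)"
  using assms
proof (induction V V' arbitrary: z z' Y t rule: list_induct2)
  case Nil
  then show ?case using order_trans[OF abs_ge_zero Nil.prems(7)[of 0]] by simp
next
  case (Cons M V M' V')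
  let ?q = "(real N + 1) * B"
  let ?z = "\<lambda>i. relu (layer N M z i)" and ?z' = "\<lambda>i. relu (layer N M' z' i)"
  have M: "\<bar>M i j\<bar> \<le> B" "\<bar>M' i j\<bar> \<le> B" "\<bar>M i j - M' i j\<bar> \<le> \<delta>" for i j
    using Cons.prems(1)[of M] Cons.prems(1)[of M'] Cons.prems(2)[of 0] by auto
  have q: "1 \<le> ?q" using Cons.prems(3) mult_mono[of 1 "real N + 1" 1 B] by simp
  have t: "0 \<le> t" using Cons.prems(7)[of 0] by linarith
  have \<delta>Y: "0 \<le> \<delta> * Y" using Cons.prems(4,5) by simp
  have lay: "\<bar>layer N M z i - layer N M' z' i\<bar> \<le> ?q * (t + \<delta> * Y)" for i
  proof -
    have "\<bar>layer N M z i - layer N M' z' i\<bar> \<le> (real N + 1) * (B * t + \<delta> * Y)"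
      by (rule abs_layer_diff_le[OF M(1,3) Cons.prems(6,4,7)])
    \<comment> \<open>Here 1 \<le> \<open>B\<close> is used, so that \<open>B\<close> can be
      factored out of both terms.\<close>
    also have "\<dots> \<le> (real N + 1) * (B * t + B * (\<delta> * Y))"
      using mult_right_mono[OF Cons.prems(3) \<delta>Y] by (intro mult_left_mono) auto
    finally show ?thesis by (simp add: algebra_simps)
  qed
  show ?case
  proof (cases V)
    case Nil
    then have "V' = []" using Cons.hyps by simp
    then show ?thesis using lay[of 0] Nil by simp
  next
    case (Cons a U)
    obtain a' U' where V': "V' = a' # U'" using Cons.hyps \<open>V = a # U\<close> by (cases V') auto
    have "\<bar>eval_net N V ?z - eval_net N V' ?z'\<bar>
        \<le> ?q ^ length V * (?q * (t + \<delta> * Y) + length V * \<delta> * (?q * Y))"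
    proof (rule Cons.IH)
      show "1 \<le> ?q * Y" using mult_mono[of 1 ?q 1 Y] q Cons.prems(4) by simp
      show "\<bar>?z' i\<bar> \<le> ?q * Y" for i
        by (rule order_trans[OF abs_relu_le abs_layer_le[OF M(2) Cons.prems(6,4)]])
      show "\<bar>?z i - ?z' i\<bar> \<le> ?q * (t + \<delta> * Y)" for i
        by (rule order_trans[OF abs_relu_diff_le lay])
      show "\<bar>(V ! l) i j - (V' ! l) i j\<bar> \<le> \<delta>" if "l < length V" for l i j
        using Cons.prems(2)[of "Suc l"] that by simp
    qed (use Cons.prems in auto)
    moreover have "?q ^ length V * (?q * (t + \<delta> * Y) + length V * \<delta> * (?q * Y))
        = ?q ^ length (M # V) * (t + length (M # V) * \<delta> * Y)"
      by (simp add: algebra_simps)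
    moreover have "eval_net N (M # V) z = eval_net N V ?z" "eval_net N (M' # V') z' = eval_net N V' ?z'"
      using Cons V' by simp_all
    ultimately show ?thesis by (simp only:)
  qed
qed

lemma measurable_eval_net:
  assumes "\<And>i. (\<lambda>x. z x i) \<in> borel_measurable M"
  shows "(\<lambda>x. eval_net N V (z x)) \<in> borel_measurable M"
  using assms
proof (induction V arbitrary: z)
  case (Cons A V)
  have lay: "(\<lambda>x. layer N A (z x) i) \<in> borel_measurable M" for i
    unfolding layer_def using Cons.prems by measurable
  have "(\<lambda>x. relu (layer N A (z x) i)) \<in> borel_measurable M" for i
    unfolding relu_def using lay by measurable
  from Cons.IH[of "\<lambda>x i. relu (layer N A (z x) i)", OF this] lay show ?case
    by (cases V) simp_all
qed simp

section \<open>Counting and covering\<close>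

text \<open>A function with at most \<open>n\<close> non-zero values is given by an association list of length \<open>n\<close>.\<close>

lemma card_sparse_functions_le:
  fixes D :: "'a set" and Z :: "int set" and n :: nat
  assumes "finite D" "finite Z" "0 \<in> Z" "D \<noteq> {}"
  defines "F \<equiv> {f :: 'a \<Rightarrow> int. {p. f p \<noteq> 0} \<subseteq> D \<and> card {p. f p \<noteq> 0} \<le> n \<and> range f \<subseteq> Z}"
  shows "finite F" "card F \<le> (card D * card Z) ^ n"
proof -
  let ?G = "\<lambda>xs p. case map_of xs p of None \<Rightarrow> 0 | Some v \<Rightarrow> v"
  let ?X = "{xs. set xs \<subseteq> D \<times> Z \<and> length xs = n}"
  have fin: "finite ?X" using assms(1,2) by (intro finite_lists_length_eq) auto
  have sub: "F \<subseteq> ?G ` ?X"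
  proof
    fix f assume f: "f \<in> F"
    let ?S = "{p. f p \<noteq> 0}"
    have fS: "finite ?S" using f assms(1) finite_subset by (auto simp: F_def)
    then obtain ps where ps: "set ps = ?S" "distinct ps" using finite_distinct_list by blast
    obtain p\<^sub>0 where p0: "p\<^sub>0 \<in> D" using assms(4) by blast
    \<comment> \<open>Padding to length exactly \<open>n\<close> with a fixed point of
      \<open>D\<close>. It is harmless, since every listed point is paired with its true value under
      \<open>f\<close>, even if that value is 0 or the point occurs twice.\<close>
    let ?qs = "ps @ replicate (n - length ps) p\<^sub>0"
    let ?xs = "map (\<lambda>p. (p, f p)) ?qs"
    have "length ps \<le> n" using f ps distinct_card[of ps] by (simp add: F_def)
    then have "?xs \<in> ?X" using f ps p0 by (auto simp: F_def)
    moreover have "f = ?G ?xs"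
    proof
      fix p show "f p = ?G ?xs p"
        unfolding map_of_map_restrict using ps by (auto simp: restrict_map_def)
    qed
    ultimately show "f \<in> ?G ` ?X" by blast
  qed
  show "finite F" using finite_subset[OF sub] fin by simp
  have "card F \<le> card ?X" using surj_card_le[OF fin sub] .
  also have "\<dots> = (card D * card Z) ^ n"
    using assms(1,2) by (simp add: card_lists_length_eq card_cartesian_product)
  finally show "card F \<le> (card D * card Z) ^ n" .
qed

text \<open>Covering numbers demand centers inside \<open>S\<close>, so \<open>inv_into\<close>
  picks one member of each non-empty fibre of \<open>code\<close>. Closeness is assumed between
  members of \<open>S\<close> themselves, hence the quasi-triangle constant does not enter.\<close>

lemma (in quasi_metric_space) covering_number_le_card:
  assumes S: "S \<subseteq> X" and T: "finite T" "code ` S \<subseteq> T"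
    and close: "\<And>s t. s \<in> S \<Longrightarrow> t \<in> S \<Longrightarrow> code s = code t \<Longrightarrow> d s t \<le> \<epsilon>"
  shows "covering_number S \<epsilon> \<le> enat (card T)"
proof -
  let ?rep = "inv_into S code"
  have fin: "finite (code ` S)" using T finite_subset by blast
  obtain e where e: "bij_betw e {..<card (code ` S)} (code ` S)"
    using ex_bij_betw_nat_finite[OF fin] by (auto simp: atLeast0LessThan)
  let ?c = "?rep \<circ> e"
  have img: "?c ` {..<card (code ` S)} = ?rep ` code ` S"
    using bij_betw_imp_surj_on[OF e] by (simp only: image_comp[symmetric])
  have "?rep ` code ` S \<subseteq> S" by (auto intro: inv_into_into)
  moreover have "S \<subseteq> (\<Union>i<card (code ` S). qball (?c i) \<epsilon>)"
  proof
    fix s assume s: "s \<in> S"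
    let ?r = "?rep (code s)"
    have r: "?r \<in> S" "code ?r = code s"
      using s by (auto intro: inv_into_into f_inv_into_f)
    have sr: "s \<in> qball ?r \<epsilon>" using close[OF r(1) s r(2)] s S by (simp add: qball_def subset_iff)
    have "?r \<in> ?c ` {..<card (code ` S)}" using img s by blast
    then obtain i where "i \<in> {..<card (code ` S)}" "?r = ?c i" by (rule imageE)
    with sr show "s \<in> (\<Union>i<card (code ` S). qball (?c i) \<epsilon>)" by (intro UN_I[of i]) simp_all
  qed
  ultimately have "covering_number S \<epsilon> \<le> enat (card (code ` S))"
    unfolding covering_number_def using img by (intro INF_lower CollectI exI[of _ ?c]) auto
  also have "\<dots> \<le> enat (card T)" using card_mono[OF T] by simp
  finally show ?thesis .
qed

section \<open>Networks as elements of the Lebesgue spaces\<close>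

lemma nn_weights_dims:
  assumes "nn_weights W" "(A, b) \<in> set W"
  shows "dim_row A > 0" "dim_col A > 0" "dim_vec b = dim_row A"
proof -
  have "\<forall>(A, b) \<in> set W. dim_row A > 0 \<and> dim_col A > 0 \<and> dim_vec b = dim_row A"
    using assms(1) unfolding nn_weights_def by blast
  from bspec[OF this assms(2)] show "dim_row A > 0" "dim_col A > 0" "dim_vec b = dim_row A"
    by simp_all
qed

text \<open>Positive dimensions make the sets under \<open>Max\<close> non-empty, so both norms are
  non-negative and each is at most their sum.\<close>

lemma entries_le_weights_linf:
  assumes W: "nn_weights W" "(A, b) \<in> set W"
  shows "i < dim_row A \<Longrightarrow> j < dim_col A \<Longrightarrow> \<bar>A $$ (i, j)\<bar> \<le> weights_linf W"
    and "i < dim_vec b \<Longrightarrow> \<bar>vec_index b i\<bar> \<le> weights_linf W"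
proof -
  let ?SA = "{\<bar>A $$ (i, j)\<bar> |i j. i < dim_row A \<and> j < dim_col A}"
  let ?Sb = "{\<bar>vec_index b i\<bar> |i. i < dim_vec b}"
  have pos: "dim_row A > 0" "dim_col A > 0" "dim_vec b > 0"
    using nn_weights_dims[OF W] by simp_all
  have finA: "finite ?SA" by (rule finite_image_set2) simp_all
  have finb: "finite ?Sb" by simp
  have leA: "\<bar>A $$ (i, j)\<bar> \<le> mat_linf A" if "i < dim_row A" "j < dim_col A" for i j
    unfolding mat_linf_def by (rule Max_ge[OF finA]) (use that in auto)
  have leb: "\<bar>vec_index b i\<bar> \<le> vec_linf b" if "i < dim_vec b" for i
    unfolding vec_linf_def by (rule Max_ge[OF finb]) (use that in auto)
  have "0 \<le> mat_linf A" "0 \<le> vec_linf b"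
    using leA[OF pos(1,2)] leb[OF pos(3)] by linarith+
  moreover have "mat_linf A + vec_linf b \<le> weights_linf W"
    unfolding weights_linf_def by (rule Max_ge) (use imageI[OF W(2), of "\<lambda>(A, b). mat_linf A + vec_linf b"] in simp_all)
  ultimately show "i < dim_row A \<Longrightarrow> j < dim_col A \<Longrightarrow> \<bar>A $$ (i, j)\<bar> \<le> weights_linf W"
    and "i < dim_vec b \<Longrightarrow> \<bar>vec_index b i\<bar> \<le> weights_linf W"
    using leA[of i j] leb[of i] by linarith+
qed

text \<open>The enumeration is that of \<open>coords\<close>; the extension by 0 suits
  \<open>eval_net\<close> and keeps every index bounded on a bounded domain.\<close>

definition input_coord :: "real ^ 'd::finite \<Rightarrow> nat \<Rightarrow> real" where
  "input_coord x i = (if i < CARD('d) then vec_nth x (from_nat_into UNIV i) else 0)"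

text \<open>The width \<open>n + CARD('d)\<close> leaves room for all inputs as well as for the at
  most \<open>n\<close> active neurons of a layer. All inputs count as active, so the enumeration
  starts with \<open>id\<close> and puts no condition on the point.\<close>

lemma NN_imp_sparse_net:
  fixes f :: "real ^ 'd::finite \<Rightarrow> real"
  assumes f: "f \<in> NN g n"
  shows "\<exists>V \<in> sparse_nets (n + CARD('d)) (real g * real n ^ g) (nat \<lfloor>ln (exp 1 * real n) ^ g\<rfloor>) n.
    f = (\<lambda>x. eval_net (n + CARD('d)) V (input_coord x))"
proof -
  let ?N = "n + CARD('d)" and ?B = "real g * real n ^ g"
  obtain W where feq: "f = (\<lambda>x. vec_index (realization W (coords x)) 0)"
    and W: "nn_weights W" "d_in W = CARD('d)" "d_out W = 1"
      "weights_l0 W \<le> n" "weights_linf W \<le> ?B"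
      "real (length W) \<le> ln (exp 1 * real n) ^ g"
    using f unfolding NN_def by blast
  have B: "0 \<le> ?B" by simp
  have "\<exists>V \<in> sparse_nets ?N ?B (length W) (weights_l0 W).
    \<forall>x z. dim_vec x = d_in W \<longrightarrow> (\<forall>i<d_in W. i \<notin> id ` {..<CARD('d)} \<longrightarrow> vec_index x i = 0) \<longrightarrow>
      (\<forall>i<CARD('d). z i = vec_index x (id i)) \<longrightarrow> vec_index (realization W x) 0 = eval_net ?N V z"
  proof (rule ex_compressed_net[OF W(1,3) _ _ _ _ _ B])
    show "\<bar>A $$ (i, j)\<bar> \<le> ?B" if "(A, b) \<in> set W" "i < dim_row A" "j < dim_col A" for A b i j
      using entries_le_weights_linf(1)[OF W(1) that] W(5) by linarith
    show "\<bar>vec_index b i\<bar> \<le> ?B" if "(A, b) \<in> set W" "i < dim_vec b" for A b i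
      using entries_le_weights_linf(2)[OF W(1) that] W(5) by linarith
  qed (use W in \<open>auto simp: Suc_leI\<close>)
  then obtain V where V: "V \<in> sparse_nets ?N ?B (length W) (weights_l0 W)"
    and eq: "\<And>x z. dim_vec x = CARD('d) \<Longrightarrow> (\<forall>i<CARD('d). z i = vec_index x i) \<Longrightarrow>
      vec_index (realization W x) 0 = eval_net ?N V z"
    using W(2) by auto
  have "length W \<le> nat \<lfloor>ln (exp 1 * real n) ^ g\<rfloor>" using W(6) by (simp add: le_nat_floor)
  then have "V \<in> sparse_nets ?N ?B (nat \<lfloor>ln (exp 1 * real n) ^ g\<rfloor>) n"
    using V W(4) by (auto simp: sparse_nets_def)
  moreover have "f = (\<lambda>x. eval_net ?N V (input_coord x))"
    unfolding feq by (intro ext eq) (auto simp: coords_def input_coord_def)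
  ultimately show ?thesis by blast
qed

text \<open>The one-layer network with zero weights is a member: its depth 1 is admissible because
  ln (e n) is at least 1.\<close>

lemma NN_nonempty:
  assumes "n \<ge> 1" shows "(NN g n :: (real ^ 'd::finite \<Rightarrow> real) set) \<noteq> {}"
proof -
  let ?A = "0\<^sub>m 1 CARD('d) :: real mat" and ?b = "0\<^sub>v 1 :: real Matrix.vec"
  let ?W = "[(?A, ?b)]"
  have A0: "?A $$ (i, j) = 0" if "i < dim_row ?A" "j < dim_col ?A" for i j
    using that by simp
  have b0: "vec_index ?b i = 0" if "i < dim_vec ?b" for i using that by simp
  have "{(i, j). i < dim_row ?A \<and> j < dim_col ?A \<and> ?A $$ (i, j) \<noteq> 0} = {}" using A0 by blast
  then have "mat_l0 ?A = 0" unfolding mat_l0_def by (simp only: card.empty)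
  moreover have "{i. i < dim_vec ?b \<and> vec_index ?b i \<noteq> 0} = {}" using b0 by blast
  then have "vec_l0 ?b = 0" unfolding vec_l0_def by (simp only: card.empty)
  moreover have "mat_linf ?A = 0" unfolding mat_linf_def
  proof (rule Max_eqI)
    have "0 < dim_row ?A \<and> 0 < dim_col ?A \<and> 0 = \<bar>?A $$ (0, 0)\<bar>" by simp
    then show "0 \<in> {\<bar>?A $$ (i, j)\<bar> |i j. i < dim_row ?A \<and> j < dim_col ?A}" by blast
    have zero: "y = 0" if y: "y \<in> {\<bar>?A $$ (i, j)\<bar> |i j. i < dim_row ?A \<and> j < dim_col ?A}" for y
    proof -
      obtain i j where "y = \<bar>?A $$ (i, j)\<bar>" "i < dim_row ?A" "j < dim_col ?A" using y by blast
      then show ?thesis using A0[of i j] by linarith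
    qed
    show "finite {\<bar>?A $$ (i, j)\<bar> |i j. i < dim_row ?A \<and> j < dim_col ?A}"
      by (rule finite_subset[of _ "{0}"]) (use zero in blast, simp)
    show "y \<le> 0" if "y \<in> {\<bar>?A $$ (i, j)\<bar> |i j. i < dim_row ?A \<and> j < dim_col ?A}" for y
      using zero[OF that] by simp
  qed
  moreover have "vec_linf ?b = 0" unfolding vec_linf_def
  proof (rule Max_eqI)
    have "0 < dim_vec ?b \<and> 0 = \<bar>vec_index ?b 0\<bar>" by simp
    then show "0 \<in> {\<bar>vec_index ?b i\<bar> |i. i < dim_vec ?b}" by blast
  qed (use b0 in auto)
  moreover have "1 \<le> ln (exp 1 * real n)" using assms by (simp add: ln_mult)
  then have "1 \<le> ln (exp 1 * real n) ^ g" by (rule one_le_power)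
  ultimately have "nn_weights ?W \<and> d_in ?W = CARD('d) \<and> d_out ?W = 1 \<and>
     weights_l0 ?W \<le> n \<and> weights_linf ?W \<le> real g * real n ^ g \<and>
     real (length ?W) \<le> ln (exp 1 * real n) ^ g"
    by (simp add: nn_weights_def d_in_def d_out_def weights_l0_def weights_linf_def)
  then show ?thesis unfolding NN_def by blast
qed

text \<open>For finite \<open>p\<close> the factor comes from integrating the constant
  \<open>t powr enn2real p\<close>. The maximum with 1 lets the same formula serve infinite
  \<open>p\<close>, where \<open>enn2real p\<close> is 0.\<close>

lemma Lp_bounded:
  assumes fin: "finite_measure M" and f: "f \<in> borel_measurable M"
    and bd: "\<And>x. x \<in> space M \<Longrightarrow> \<bar>f x\<bar> \<le> t" and t: "0 \<le> t" and p: "p > 0"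
  shows "f \<in> Lp_fun p M"
    and "Lp_norm p M f \<le> max 1 (measure M (space M) powr (1 / enn2real p)) * t"
proof -
  interpret finite_measure M by (rule fin)
  note [measurable] = f
  have "f \<in> Lp_fun p M \<and>
    Lp_norm p M f \<le> max 1 (measure M (space M) powr (1 / enn2real p)) * t"
  proof (cases "p = \<infinity>")
    case True
    have le: "esssup M (\<lambda>x. ennreal \<bar>f x\<bar>) \<le> ennreal t"
      by (rule esssup_I) (use bd in \<open>auto intro!: AE_I2 ennreal_leI\<close>)
    then have "enn2real (esssup M (\<lambda>x. ennreal \<bar>f x\<bar>)) \<le> t" using t by (intro enn2real_leI)
    also have "t \<le> max 1 (measure M (space M) powr (1 / enn2real p)) * t"
      using mult_right_mono[OF max.cobounded1 t, of 1] by simp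
    finally show ?thesis
      using True le_less_trans[OF le ennreal_less_top] by (simp add: Lp_norm_def Lp_fun_def)
  next
    case False
    define q where "q = enn2real p"
    have q: "q > 0" using p False by (simp add: q_def enn2real_positive_iff less_top)
    have int: "integrable M (\<lambda>x. \<bar>f x\<bar> powr q)"
      by (rule integrable_const_bound[of _ "t powr q"])
        (use bd q in \<open>auto intro!: AE_I2 powr_mono2\<close>)
    have "(\<integral>x. \<bar>f x\<bar> powr q \<partial>M) \<le> (\<integral>x. t powr q \<partial>M)"
      using bd q by (intro integral_mono int) (auto intro!: powr_mono2)
    then have "(\<integral>x. \<bar>f x\<bar> powr q \<partial>M) powr (1 / q) \<le> (measure M (space M) * t powr q) powr (1 / q)"
      using q by (intro powr_mono2) auto
    also have "\<dots> = measure M (space M) powr (1 / q) * t"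
      using q t by (simp add: powr_mult powr_powr)
    also have "\<dots> \<le> max 1 (measure M (space M) powr (1 / q)) * t"
      using t by (intro mult_right_mono) auto
    finally show ?thesis using False int by (simp add: Lp_norm_def Lp_fun_def q_def)
  qed
  then show "f \<in> Lp_fun p M"
    and "Lp_norm p M f \<le> max 1 (measure M (space M) powr (1 / enn2real p)) * t"
    by auto
qed

lemma measurable_input_coord:
  "(\<lambda>x :: real ^ 'd::finite. input_coord x i) \<in> borel_measurable (lebesgue_on \<Omega>)"
proof -
  have "continuous_on UNIV (\<lambda>x :: real ^ 'd. input_coord x i)"
    unfolding input_coord_def by (cases "i < CARD('d)") (auto intro!: continuous_intros)
  then have "(\<lambda>x :: real ^ 'd. input_coord x i) \<in> borel_measurable lebesgue"
    by (intro measurable_completion) (simp add: borel_measurable_continuous_onI)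
  then show ?thesis by (rule measurable_restrict_space1)
qed

section \<open>Rounding the weights\<close>

text \<open>The depth is recorded separately, since positions beyond the last layer get 0 just as
  vanishing weights do. Rounding by floor sends 0 to 0 and so preserves sparsity.\<close>

definition mesh_code ::
  "real \<Rightarrow> (nat \<Rightarrow> nat \<Rightarrow> real) list \<Rightarrow> nat \<times> (nat \<times> nat \<times> nat \<Rightarrow> int)" where
  "mesh_code \<delta> V =
     (length V, \<lambda>(l, i, j). if l < length V then \<lfloor>(V ! l) i j / \<delta>\<rfloor> else 0)"

lemma mesh_code_eq_imp_close:
  assumes "mesh_code \<delta> V = mesh_code \<delta> V'" "\<delta> > 0" "l < length V"
  shows "\<bar>(V ! l) i j - (V' ! l) i j\<bar> \<le> \<delta>"
proof -
  have "length V' = length V" using assms(1) by (simp add: mesh_code_def)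
  moreover have "snd (mesh_code \<delta> V) (l, i, j) = snd (mesh_code \<delta> V') (l, i, j)"
    using assms(1) by simp
  ultimately have "\<lfloor>(V ! l) i j / \<delta>\<rfloor> = \<lfloor>(V' ! l) i j / \<delta>\<rfloor>"
    using assms(3) by (simp add: mesh_code_def)
  then have "\<bar>(V ! l) i j / \<delta> - (V' ! l) i j / \<delta>\<bar> \<le> 1" by linarith
  then show ?thesis using assms(2) by (simp add: field_simps abs_le_iff)
qed

text \<open>A code consists of one of \<open>K\<close> depths and an integer function on
  \<open>K * (N * (N + 1))\<close> positions with at most \<open>n\<close> non-zero values, all
  within the rounded range of the weights.\<close>

lemma card_mesh_codes_le:
  assumes "\<delta> > 0" "N \<ge> 1" "K \<ge> 1" "0 \<le> B"
  obtains T where "finite T" "mesh_code \<delta> ` sparse_nets N B K n \<subseteq> T"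
    "real (card T) \<le> real K * (real (K * (N * (N + 1))) * (2 * (B / \<delta>) + 3)) ^ n"
proof -
  let ?D = "{..<K} \<times> {..<N} \<times> {..N}" and ?Z = "{- \<lceil>B / \<delta>\<rceil>..\<lceil>B / \<delta>\<rceil>}"
  let ?F = "{f :: nat \<times> nat \<times> nat \<Rightarrow> int.
    {p. f p \<noteq> 0} \<subseteq> ?D \<and> card {p. f p \<noteq> 0} \<le> n \<and> range f \<subseteq> ?Z}"
  have "(0, 0, 0) \<in> ?D" using assms by simp
  then have D: "finite ?D" "?D \<noteq> {}" by (simp, blast)
  have "0 \<le> B / \<delta>" using assms by simp
  then have ceil: "0 \<le> \<lceil>B / \<delta>\<rceil>" by linarith
  have Z: "finite ?Z" "0 \<in> ?Z" using ceil by auto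
  note F = card_sparse_functions_le[OF D(1) Z D(2), of n]
  have "mesh_code \<delta> V \<in> {1..K} \<times> ?F" if V: "V \<in> sparse_nets N B K n" for V
  proof -
    let ?f = "snd (mesh_code \<delta> V)"
    let ?S = "SIGMA l : {..<length V}. supp (V ! l)"
    have suppN: "supp (V ! l) \<subseteq> {..<N} \<times> {..N}" if "l < length V" for l
      using V that by (auto simp: sparse_nets_def)
    then have fin: "finite (supp (V ! l))" if "l < length V" for l
      using that finite_subset by blast
    have sub: "{p. ?f p \<noteq> 0} \<subseteq> ?S"
    proof
      fix p assume p: "p \<in> {p. ?f p \<noteq> 0}"
      obtain l i j where [simp]: "p = (l, i, j)" by (cases p)
      \<comment> \<open>As floor sends 0 to 0, a non-zero code value needs a non-zero
        weight.\<close>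
      have "l < length V \<and> (V ! l) i j \<noteq> 0"
        using p by (cases "l < length V") (auto simp: mesh_code_def)
      then show "p \<in> ?S" by (simp add: supp_def)
    qed
    have "length V \<le> K" using V by (simp add: sparse_nets_def)
    then have SD: "?S \<subseteq> ?D" by (intro Sigma_mono suppN) auto
    have "card {p. ?f p \<noteq> 0} \<le> card ?S"
      by (rule card_mono[OF _ sub]) (use fin in auto)
    moreover have "card ?S = (\<Sum>M\<leftarrow>V. card (supp M))"
      using fin by (simp add: sum_list_sum_nth atLeast0LessThan)
    moreover have "(\<Sum>M\<leftarrow>V. card (supp M)) \<le> n" using V by (simp add: sparse_nets_def)
    ultimately have card: "card {p. ?f p \<noteq> 0} \<le> n" by linarith
    have fZ: "?f p \<in> ?Z" for p
    proof -
      obtain l i j where p: "p = (l, i, j)" by (cases p)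
      show ?thesis
      proof (cases "l < length V")
        case True
        then have "V ! l \<in> set V" by simp
        then have "\<bar>(V ! l) i j\<bar> \<le> B" using V by (auto simp: sparse_nets_def)
        then have "(V ! l) i j / \<delta> \<le> B / \<delta>" "- (B / \<delta>) \<le> (V ! l) i j / \<delta>"
          using assms(1) by (auto simp: field_simps abs_le_iff)
        then have "\<lfloor>(V ! l) i j / \<delta>\<rfloor> \<le> \<lceil>B / \<delta>\<rceil>" "- \<lceil>B / \<delta>\<rceil> \<le> \<lfloor>(V ! l) i j / \<delta>\<rfloor>"
          by linarith+
        then show ?thesis using p True by (simp add: mesh_code_def)
      qed (use p ceil in \<open>simp add: mesh_code_def\<close>)
    qed
    have "{p. ?f p \<noteq> 0} \<subseteq> ?D \<and> card {p. ?f p \<noteq> 0} \<le> n \<and> range ?f \<subseteq> ?Z"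
      using card by (intro conjI order_trans[OF sub SD] image_subsetI fZ)
    then have "?f \<in> ?F" by (simp only: mem_Collect_eq)
    moreover have "fst (mesh_code \<delta> V) \<in> {1..K}"
      using V by (cases V) (auto simp: mesh_code_def sparse_nets_def)
    ultimately show ?thesis by (simp add: mem_Times_iff)
  qed
  then have sub: "mesh_code \<delta> ` sparse_nets N B K n \<subseteq> {1..K} \<times> ?F" by (rule image_subsetI)
  have card: "real (card ({1..K} \<times> ?F)) \<le> real K * (real (K * (N * (N + 1))) * (2 * (B / \<delta>) + 3)) ^ n"
  proof -
    \<comment> \<open>An integer interval symmetric about 0 has 2 ceil(x) + 1 elements, and ceil(x)
      \<le> x + 1.\<close>
    have "real (card ?Z) \<le> 2 * (B / \<delta>) + 3" using ceil by simp linarith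
    then have "real (card ?D) * real (card ?Z) \<le> real (card ?D) * (2 * (B / \<delta>) + 3)"
      by (rule mult_left_mono) simp
    moreover have "card ?D = K * (N * (N + 1))" by (simp add: card_cartesian_product)
    ultimately have "real (card ?D * card ?Z) \<le> real (K * (N * (N + 1))) * (2 * (B / \<delta>) + 3)"
      by (simp only: of_nat_mult)
    then have "real (card ?D * card ?Z) ^ n \<le> (real (K * (N * (N + 1))) * (2 * (B / \<delta>) + 3)) ^ n"
      by (intro power_mono) auto
    moreover have "real (card ?F) \<le> real (card ?D * card ?Z) ^ n"
      using of_nat_mono[OF F(2), where 'a = real] by (simp only: of_nat_power)
    ultimately have "real (card ?F) \<le> (real (K * (N * (N + 1))) * (2 * (B / \<delta>) + 3)) ^ n" by linarith
    then have "real K * real (card ?F) \<le> real K * (real (K * (N * (N + 1))) * (2 * (B / \<delta>) + 3)) ^ n"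
      by (intro mult_left_mono) auto
    then show ?thesis by (simp only: card_cartesian_product card_atLeastAtMost of_nat_mult) simp
  qed
  have "finite ({1..K} \<times> ?F)" by (rule finite_cartesian_product[OF finite_atLeastAtMost F(1)])
  from that[OF this sub card] show thesis .
qed

section \<open>Growth of the number of codes\<close>

lemma polylog_bdd_above:
  fixes \<delta> c :: real assumes "\<delta> > 0"
  shows "bdd_above ((\<lambda>n. c * real n * ln (exp 1 * real n) ^ k / real n powr (1 + \<delta>)) ` {1..})"
proof -
  \<comment> \<open>Powers of the logarithm are negligible against
    \<open>real n powr \<delta>\<close>; the convergent sequence is then bounded.\<close>
  have "(\<lambda>n. real n * ln (exp 1 * real n) ^ k / real n powr (1 + \<delta>)) \<longlonglongrightarrow> 0"
    using assms by real_asymp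
  from tendsto_mult_left[OF this, of c]
  have "Bseq (\<lambda>n. c * real n * ln (exp 1 * real n) ^ k / real n powr (1 + \<delta>))"
    by (intro convergent_imp_Bseq convergentI[of _ 0]) (simp add: mult.assoc)
  then obtain b where b: "\<And>n. norm (c * real n * ln (exp 1 * real n) ^ k / real n powr (1 + \<delta>)) \<le> b"
    by (auto simp: Bseq_def)
  show ?thesis
    by (rule bdd_aboveI2[of _ _ b]) (rule order_trans[OF abs_ge_self b[unfolded real_norm_def]])
qed

text \<open>Put u = ln (e n). Then N + 1 and B are at most exponentials of multiples of u, and K
  \<le> u^g. Hence ((N + 1) B)^K, and with it B / \<delta>, is at most the exponential of a multiple
  of u^(g+1). Raising to the power \<open>n\<close> brings the factor \<open>n\<close> into the
  exponent.\<close>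

lemma mesh_count_le_exp:
  fixes C Y \<alpha> :: real and n g d :: nat
  assumes n: "n \<ge> 1" and g: "g \<ge> 1" and C: "C \<ge> 1" and Y: "Y \<ge> 1" and \<alpha>: "\<alpha> \<ge> 0"
  defines "N \<equiv> n + d" and "B \<equiv> real g * real n ^ g" and "K \<equiv> nat \<lfloor>ln (exp 1 * real n) ^ g\<rfloor>"
  defines "\<delta> \<equiv> real n powr (- \<alpha>) / (C * real K * Y * ((real N + 1) * B) ^ K)"
  shows "K \<ge> 1" "B \<ge> 1" "\<delta> > 0"
    and "real K * (real (K * (N * (N + 1))) * (2 * (B / \<delta>) + 3)) ^ n
      \<le> exp ((2 * real d + (4 * real g + \<alpha> + C + Y + real d + 14)) * real n * ln (exp 1 * real n) ^ (g + 1))"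
proof -
  define u where "u = ln (exp 1 * real n)"
  define m where "m = u ^ (g + 1)"
  let ?q = "(real N + 1) * B" and ?a = "real d + 2"
  have u1: "1 \<le> u" using n by (simp add: u_def ln_mult)
  have expl: "exp u = exp 1 * real n" using n by (simp add: u_def)
  have ug: "1 \<le> u ^ g" using u1 by (rule one_le_power)
  have m: "m = u * u ^ g" by (simp add: m_def)
  have um: "u \<le> m" and ugm: "u ^ g \<le> m"
    unfolding m using mult_left_mono[OF ug, of u] mult_right_mono[OF u1, of "u ^ g"] u1 by simp_all
  have m1: "1 \<le> m" using u1 um by linarith
  \<comment> \<open>Used with \<open>t = u\<close> and \<open>t = m\<close>, both at least 1, to
    absorb constants into exponents.\<close>
  have const: "x \<le> exp (x * t)" if "0 \<le> x" "1 \<le> t" for x t :: real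
    using exp_ge_add_one_self[of "x * t"] mult_left_mono[OF that(2,1)] by linarith
  show K1: "K \<ge> 1" using ug by (simp add: K_def u_def le_nat_floor)
  have Ku: "real K \<le> u ^ g" using ug by (simp add: K_def u_def[symmetric])
  have Km: "real K \<le> exp m" using Ku ugm exp_ge_add_one_self[of m] by linarith
  have "1 \<le> real n ^ g" using n by (intro one_le_power) simp
  then show B1: "B \<ge> 1" using mult_mono[of 1 "real g" 1 "real n ^ g"] g by (simp add: B_def)
  have q1: "1 \<le> ?q" using mult_mono[of 1 "real N + 1" 1 B] B1 by simp
  then have qK: "1 \<le> ?q ^ K" by (rule one_le_power)
  have "1 \<le> C * real K" using mult_mono[of 1 C 1 "real K"] C K1 by simp
  then have CKY: "1 \<le> C * real K * Y" using mult_mono[of 1 "C * real K" 1 Y] Y by simp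
  then have D1: "1 \<le> C * real K * Y * ?q ^ K" using mult_mono[of 1 "C * real K * Y" 1 "?q ^ K"] qK by simp
  then show \<delta>: "\<delta> > 0" using n by (simp add: \<delta>_def)
  have nu: "real n \<le> exp u"
    using mult_right_mono[of 1 "exp 1" "real n"] by (simp add: expl)
  have nm: "real n \<le> exp m" using nu um by (meson exp_le_cancel_iff order_trans)
  have Nu: "real N + 1 \<le> exp (?a * u)"
  proof -
    have "real d + 2 \<le> exp (real d + 1)" using exp_ge_add_one_self[of "real d + 1"] by linarith
    also have "\<dots> \<le> exp ((real d + 1) * u)" using mult_left_mono[OF u1, of "real d + 1"] by simp
    finally have d: "real d + 2 \<le> exp ((real d + 1) * u)" .
    \<comment> \<open>This is n + d + 1 \<le> (d + 2) n, valid since n is at least 1.\<close>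
    have "real N + 1 \<le> (real d + 2) * real n"
      using mult_left_mono[of 1 "real n" "real d + 1"] n by (simp add: N_def algebra_simps)
    also have "\<dots> \<le> exp ((real d + 1) * u) * exp u" using d nu by (intro mult_mono) auto
    also have "\<dots> = exp (?a * u)" by (simp add: exp_add[symmetric] algebra_simps)
    finally show ?thesis .
  qed
  have Bu: "B \<le> exp (2 * real g * u)"
  proof -
    have "real n ^ g \<le> exp u ^ g" using nu by (intro power_mono) auto
    then have "B \<le> exp (real g * u) * exp u ^ g"
      unfolding B_def using const[OF _ u1, of "real g"] by (intro mult_mono) auto
    also have "\<dots> = exp (2 * real g * u)"
      by (simp add: exp_of_nat_mult[symmetric] exp_add[symmetric])
    finally show ?thesis .
  qed
  have qu: "?q \<le> exp ((?a + 2 * real g) * u)"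
    using mult_mono[OF Nu Bu] B1 by (simp add: exp_add[symmetric] algebra_simps)
  have qKm: "?q ^ K \<le> exp ((?a + 2 * real g) * m)"
  proof -
    have "?q ^ K \<le> exp ((?a + 2 * real g) * u) ^ K" using qu q1 by (intro power_mono) auto
    also have "\<dots> = exp ((?a + 2 * real g) * (real K * u))"
      by (simp add: exp_of_nat_mult[symmetric] algebra_simps)
    \<comment> \<open>The depth bound u^g raises the exponent from u to m = u^(g+1).\<close>
    also have "real K * u \<le> m" using mult_right_mono[OF Ku, of u] u1 by (simp add: m mult.commute)
    finally show ?thesis by (simp add: mult_left_mono)
  qed
  have n\<alpha>: "real n powr \<alpha> \<le> exp (\<alpha> * m)"
  proof -
    have "u = 1 + ln (real n)" using n by (simp add: u_def ln_mult)
    then have "ln (real n) \<le> m" using um by linarith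
    then show ?thesis using n \<alpha> by (simp add: powr_def mult_left_mono)
  qed
  have na1: "1 \<le> real n powr \<alpha>" using n \<alpha> by (intro ge_one_powr_ge_zero) auto
  have B\<delta>: "B / \<delta> = B * real n powr \<alpha> * (C * real K * Y * ?q ^ K)"
    by (simp add: \<delta>_def powr_minus field_simps)
  have "1 \<le> B * real n powr \<alpha>" using mult_mono[OF B1 na1] B1 by simp
  from mult_mono[OF this D1] have B\<delta>1: "1 \<le> B / \<delta>" unfolding B\<delta> using B1 by simp
  have Bm: "B \<le> exp (2 * real g * m)"
    using Bu mult_left_mono[OF um, of "2 * real g"] by (simp add: order_trans)
  have "B / \<delta> \<le> exp (2 * real g * m) * exp (\<alpha> * m)
      * (exp (C * m) * exp m * exp (Y * m) * exp ((?a + 2 * real g) * m))"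
    unfolding B\<delta> using Bm n\<alpha> const[OF _ m1, of C] const[OF _ m1, of Y] Km qKm C Y B1 qK
    by (intro mult_mono) auto
  \<comment> \<open>The 3 collects 1 from the factor \<open>real K\<close> and 2 from
    \<open>?a\<close>.\<close>
  also have "\<dots> = exp ((4 * real g + \<alpha> + C + Y + real d + 3) * m)"
    by (simp add: exp_add[symmetric] algebra_simps)
  finally have B\<delta>m: "B / \<delta> \<le> exp ((4 * real g + \<alpha> + C + Y + real d + 3) * m)" .
  have Nm: "real N + 1 \<le> exp (?a * m)"
    using Nu mult_left_mono[OF um, of ?a] by (simp add: order_trans)
  have "2 * (B / \<delta>) + 3 \<le> 5 * (B / \<delta>)" using B\<delta>1 by linarith
  also have "\<dots> \<le> exp (5 * m) * exp ((4 * real g + \<alpha> + C + Y + real d + 3) * m)"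
    using const[OF _ m1, of 5] B\<delta>m B\<delta>1 by (intro mult_mono) auto
  finally have cnt: "2 * (B / \<delta>) + 3 \<le> exp (5 * m) * exp ((4 * real g + \<alpha> + C + Y + real d + 3) * m)" .
  have "real (K * (N * (N + 1))) * (2 * (B / \<delta>) + 3)
     \<le> (exp m * (exp (?a * m) * exp (?a * m))) * (exp (5 * m) * exp ((4 * real g + \<alpha> + C + Y + real d + 3) * m))"
  proof (rule mult_mono[OF _ cnt])
    have "real K * (real N * (real N + 1)) \<le> exp m * (exp (?a * m) * exp (?a * m))"
      using Km Nm by (intro mult_mono) auto
    then show "real (K * (N * (N + 1))) \<le> exp m * (exp (?a * m) * exp (?a * m))"
      by (simp add: algebra_simps)
  qed (use B\<delta>1 in auto)
  \<comment> \<open>The 13 is 1 from \<open>K\<close>, 4 from the two factors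
    \<open>exp (?a * m)\<close>, 5 from the numeral and 3 from the bound on
    \<open>B / \<delta>\<close>.\<close>
  also have "\<dots> = exp ((2 * real d + (4 * real g + \<alpha> + C + Y + real d + 13)) * m)" (is "_ = exp (?b * m)")
    by (simp add: exp_add[symmetric] algebra_simps)
  finally have base: "real (K * (N * (N + 1))) * (2 * (B / \<delta>) + 3) \<le> exp (?b * m)" .
  have "real K * (real (K * (N * (N + 1))) * (2 * (B / \<delta>) + 3)) ^ n \<le> exp m * exp (?b * m) ^ n"
    using Km base B\<delta>1 by (intro mult_mono power_mono) auto
  also have "\<dots> = exp (m + real n * (?b * m))"
    by (simp add: exp_of_nat_mult[symmetric] exp_add[symmetric])
  \<comment> \<open>The factor for the depth costs m \<le> n m, which turns 13 into 14.\<close>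
  also have "\<dots> \<le> exp ((?b + 1) * real n * m)"
    using mult_right_mono[of 1 "real n" m] n m1 by (simp add: algebra_simps)
  finally show "real K * (real (K * (N * (N + 1))) * (2 * (B / \<delta>) + 3)) ^ n
      \<le> exp ((2 * real d + (4 * real g + \<alpha> + C + Y + real d + 14)) * real n * ln (exp 1 * real n) ^ (g + 1))"
    by (simp add: m_def u_def add.assoc)
qed

section \<open>Covering the network classes in the Lebesgue spaces\<close>

lemma input_coord_bounded:
  fixes \<Omega> :: "(real ^ 'd::finite) set"
  assumes "bounded \<Omega>"
  obtains Y where "1 \<le> Y" "\<And>x i. x \<in> \<Omega> \<Longrightarrow> \<bar>input_coord x i\<bar> \<le> Y"
proof -
  obtain b where b: "\<And>x. x \<in> \<Omega> \<Longrightarrow> norm x \<le> b" using assms by (auto simp: bounded_iff)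
  have "\<bar>input_coord x i\<bar> \<le> max 1 b" if "x \<in> \<Omega>" for x i
  proof (cases "i < CARD('d)")
    case True
    then show ?thesis
      using component_le_norm_cart[of x "from_nat_into UNIV i"] b[OF that] by (simp add: input_coord_def)
  qed (simp add: input_coord_def)
  then show thesis by (intro that[of "max 1 b"]) simp_all
qed

theorem proposition1p16:
  fixes \<Omega> :: "(real ^ 'd::finite) set" and g :: nat and p :: ennreal
  assumes "g \<ge> 1"
    and "\<Omega> \<in> sets lebesgue" and "bounded \<Omega>"
    and "p > 0"
  shows "quasi_metric_space.controlled_complexity
           (Lp_space p (lebesgue_on \<Omega>)) (Lp_dist p (lebesgue_on \<Omega>))
           (\<lambda>n. Lp_class p (lebesgue_on \<Omega>) ` NN g n)"
proof -
  let ?M = "lebesgue_on \<Omega>"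
  interpret quasi_metric_space "Lp_space p ?M" "Lp_dist p ?M"
    by (rule quasi_metric_space_Lp[OF assms(4)])
  have fin: "finite_measure ?M"
    using bounded_set_imp_lmeasurable[OF assms(3,2)] by (rule finite_measure_lebesgue_on)
  have space: "space ?M = \<Omega>" by simp
  obtain Y where Y: "1 \<le> Y" and inp: "\<And>x i. x \<in> \<Omega> \<Longrightarrow> \<bar>input_coord x i\<bar> \<le> Y"
    using input_coord_bounded[OF assms(3)] by blast
  define C where "C = max 1 (measure ?M (space ?M) powr (1 / enn2real p))"
  have C: "1 \<le> C" by (simp add: C_def)
  let ?N = "\<lambda>n. n + CARD('d)" and ?B = "\<lambda>n. real g * real n ^ g"
  let ?K = "\<lambda>n. nat \<lfloor>ln (exp 1 * real n) ^ g\<rfloor>"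
  let ?nets = "\<lambda>n. sparse_nets (?N n) (?B n) (?K n) n"
  let ?R = "\<lambda>n V x. eval_net (?N n) V (input_coord x)"
  let ?A = "\<lambda>n. Lp_class p ?M ` NN g n"
  have B1: "1 \<le> ?B n" if "n \<ge> 1" for n
    by (rule mesh_count_le_exp(2)[OF that assms(1) C Y order_refl])
  have Lp: "?R n V \<in> Lp_fun p ?M" if n: "n \<ge> 1" and V: "V \<in> ?nets n" for n V
  proof (rule Lp_bounded(1)[OF fin _ _ _ assms(4)])
    let ?q = "(real (?N n) + 1) * ?B n"
    let ?t = "\<bar>eval_net (?N n) V (\<lambda>_. 0)\<bar> + ?q ^ length V * Y"
    show "?R n V \<in> borel_measurable ?M" by (rule measurable_eval_net[OF measurable_input_coord])
    show "\<bar>?R n V x\<bar> \<le> ?t" if "x \<in> space ?M" for x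
    proof -
      \<comment> \<open>The network is compared with itself at the zero input: no change of weights,
        input distance at most \<open>Y\<close>. So it is bounded on the domain.\<close>
      have "\<bar>?R n V x - eval_net (?N n) V (\<lambda>_. 0)\<bar> \<le> ?q ^ length V * (Y + real (length V) * 0 * Y)"
        by (rule abs_eval_net_diff_le[OF refl])
          (use V Y inp that B1[OF n] in \<open>auto simp: sparse_nets_def\<close>)
      then show ?thesis by simp
    qed
    show "0 \<le> ?t" using Y by simp
  qed
  have net: "\<exists>V\<in>?nets n. F = Lp_class p ?M (?R n V)" if F: "F \<in> ?A n" for n F
  proof -
    from F obtain f :: "real ^ 'd \<Rightarrow> real" where f: "f \<in> NN g n" "F = Lp_class p ?M f" by blast
    from NN_imp_sparse_net[OF f(1)] f(2) show ?thesis by blast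
  qed
  have sub: "?A n \<subseteq> Lp_space p ?M" if "n \<ge> 1" for n
    using net Lp[OF that] unfolding Lp_space_def by blast
  have cover: "\<exists>c\<ge>0. \<forall>n\<ge>1. ereal_of_enat (covering_number (qball x r \<inter> ?A n) (real n powr (- \<alpha>)))
      \<le> ereal (exp (c * real n * ln (exp 1 * real n) ^ (g + 1)))" if \<alpha>: "\<alpha> > 0" for \<alpha> x r
  proof (intro exI conjI allI impI)
    let ?c = "2 * real CARD('d) + (4 * real g + \<alpha> + C + Y + real CARD('d) + 14)"
    show "0 \<le> ?c" using \<alpha> C Y by simp
    fix n :: nat assume n: "n \<ge> 1"
    let ?q = "(real (?N n) + 1) * ?B n"
    let ?S = "qball x r \<inter> ?A n"
    \<comment> \<open>The mesh solves \<open>?q ^ ?K n * (real (?K n) * \<delta> * Y) = real n powr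
      (- \<alpha>) / C\<close>; dividing by \<open>C\<close> pays for the passage from the uniform
      bound to the norm.\<close>
    define \<delta> where "\<delta> = real n powr (- \<alpha>) / (C * real (?K n) * Y * ?q ^ ?K n)"
    note cnt = mesh_count_le_exp[OF n assms(1) C Y less_imp_le[OF \<alpha>]]
    have K1: "?K n \<ge> 1" by (rule cnt(1))
    have \<delta>: "\<delta> > 0" unfolding \<delta>_def by (rule cnt(3))
    have count: "real (?K n) * (real (?K n * (?N n * (?N n + 1))) * (2 * (?B n / \<delta>) + 3)) ^ n
        \<le> exp (?c * real n * ln (exp 1 * real n) ^ (g + 1))"
      unfolding \<delta>_def by (rule cnt(4))
    have q1: "1 \<le> ?q" using mult_mono[of 1 "real (?N n) + 1" 1 "?B n"] B1[OF n] by simp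
    obtain T where T: "finite T" "mesh_code \<delta> ` ?nets n \<subseteq> T"
      "real (card T) \<le> real (?K n) * (real (?K n * (?N n * (?N n + 1))) * (2 * (?B n / \<delta>) + 3)) ^ n"
    proof (rule card_mesh_codes_le[OF \<delta> _ K1, of "?N n" "?B n" n])
      show "1 \<le> ?N n" using n by simp
      show "0 \<le> ?B n" by simp
    qed
    \<comment> \<open>Fixing one network per class makes the mesh code a function on
      \<open>?S\<close>. Applying the covering lemma to \<open>?S\<close> itself places the centers
      in the ball as well as in the network set.\<close>
    have "\<forall>F\<in>?S. \<exists>V. V \<in> ?nets n \<and> F = Lp_class p ?M (?R n V)" using net by blast
    then obtain V where V: "\<And>F. F \<in> ?S \<Longrightarrow> V F \<in> ?nets n"
      and FV: "\<And>F. F \<in> ?S \<Longrightarrow> F = Lp_class p ?M (?R n (V F))"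
      by (metis bchoice)
    have "covering_number ?S (real n powr (- \<alpha>)) \<le> enat (card T)"
    proof (rule covering_number_le_card[OF _ T(1), of ?S "mesh_code \<delta> \<circ> V"])
      show "?S \<subseteq> Lp_space p ?M" using sub[OF n] by blast
      show "(mesh_code \<delta> \<circ> V) ` ?S \<subseteq> T" using V T(2) by auto
      fix F G assume F: "F \<in> ?S" and G: "G \<in> ?S" and "(mesh_code \<delta> \<circ> V) F = (mesh_code \<delta> \<circ> V) G"
      then have code: "mesh_code \<delta> (V F) = mesh_code \<delta> (V G)" by simp
      then have len: "length (V F) = length (V G)" by (simp add: mesh_code_def)
      let ?t = "real n powr (- \<alpha>) / C"
      have diff: "\<bar>?R n (V F) x - ?R n (V G) x\<bar> \<le> ?t" if x: "x \<in> \<Omega>" for x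
      proof -
        have L: "length (V F) \<le> ?K n" using V[OF F] by (simp add: sparse_nets_def)
        have "\<bar>?R n (V F) x - ?R n (V G) x\<bar> \<le> ?q ^ length (V F) * (0 + length (V F) * \<delta> * Y)"
        proof (rule abs_eval_net_diff_le[OF len])
          show "\<bar>M i j\<bar> \<le> ?B n" if "M \<in> set (V F) \<union> set (V G)" for M i j
            using that V[OF F] V[OF G] by (auto simp: sparse_nets_def)
          show "\<bar>(V F ! l) i j - (V G ! l) i j\<bar> \<le> \<delta>" if "l < length (V F)" for l i j
            using mesh_code_eq_imp_close[OF code \<delta> that] .
        qed (use B1[OF n] \<delta> Y inp[OF x] in simp_all)
        \<comment> \<open>The actual depth may be replaced by its maximum because 1 \<le>
          \<open>?q\<close>.\<close>
        also have "\<dots> \<le> ?q ^ ?K n * (real (?K n) * \<delta> * Y)"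
          using q1 L \<delta> Y by (intro mult_mono power_increasing) auto
        also have "\<dots> = ?t"
        proof -
          have "Q * (k * (a / (C * k * Y * Q)) * Y) = a / C" if "Q \<noteq> 0" "k \<noteq> 0" for Q k a :: real
            using that Y C by simp
          moreover have "?q ^ ?K n \<noteq> 0" "real (?K n) \<noteq> 0" using one_le_power[OF q1, of "?K n"] K1 by linarith+
          ultimately show ?thesis unfolding \<delta>_def by blast
        qed
        finally show ?thesis .
      qed
      note LpF = Lp[OF n V[OF F]] and LpG = Lp[OF n V[OF G]]
      have "Lp_dist p ?M F G = Lp_norm p ?M (\<lambda>x. ?R n (V F) x - ?R n (V G) x)"
        using Lp_dist_class[OF LpF LpG] FV[OF F] FV[OF G] by simp
      also have "\<dots> \<le> C * ?t" unfolding C_def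
        by (rule Lp_bounded(2)[OF fin _ _ _ assms(4)])
          (use diff C Lp_fun_measurable[OF LpF] Lp_fun_measurable[OF LpG] in \<open>auto simp: C_def\<close>)
      finally show "Lp_dist p ?M F G \<le> real n powr (- \<alpha>)" using C by simp
    qed
    then have "ereal_of_enat (covering_number ?S (real n powr (- \<alpha>))) \<le> ereal (real (card T))"
      using ereal_of_enat_le_iff[of _ "enat (card T)"] by simp
    also have "\<dots> \<le> ereal (exp (?c * real n * ln (exp 1 * real n) ^ (g + 1)))"
      using T(3) count by simp
    finally show "ereal_of_enat (covering_number ?S (real n powr (- \<alpha>)))
      \<le> ereal (exp (?c * real n * ln (exp 1 * real n) ^ (g + 1)))" .
  qed
  show ?thesis unfolding controlled_complexity_def
  proof (intro conjI allI impI ballI)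
    fix n :: nat assume "1 \<le> n"
    then show "?A n \<noteq> {}" "?A n \<subseteq> Lp_space p ?M" using NN_nonempty[of n g] sub by auto
  next
    fix \<alpha> r :: real and x assume "0 < \<alpha>"
    from cover[OF this, of x r] obtain c where c: "c \<ge> 0"
      "\<forall>n\<ge>1. ereal_of_enat (covering_number (qball x r \<inter> ?A n) (real n powr (- \<alpha>)))
        \<le> ereal (exp (c * real n * ln (exp 1 * real n) ^ (g + 1)))" by blast
    \<comment> \<open>The bound holds from n = 1 on, so 1 serves as the threshold.\<close>
    let ?\<eta> = "\<lambda>n. c * real n * ln (exp 1 * real n) ^ (g + 1)"
    have "0 \<le> ?\<eta> n" if "n \<ge> 1" for n
    proof -
      have "0 \<le> ln (exp 1 * real n)" using that by (simp add: ln_mult)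
      then show ?thesis using c(1) by simp
    qed
    moreover have "bdd_above ((\<lambda>n. ?\<eta> n / real n powr (1 + \<epsilon>)) ` {1..})" if "\<epsilon> > 0" for \<epsilon>
      by (rule polylog_bdd_above[OF that])
    ultimately show "\<exists>n\<^sub>0\<ge>1. \<exists>\<eta>. (\<forall>n\<ge>1. 0 \<le> \<eta> n) \<and>
        (\<forall>\<delta>>0. bdd_above ((\<lambda>n. \<eta> n / real n powr (1 + \<delta>)) ` {1..})) \<and>
        (\<forall>n\<ge>n\<^sub>0. ereal_of_enat (covering_number (qball x r \<inter> ?A n) (real n powr (- \<alpha>)))
          \<le> ereal (exp (\<eta> n)))"
      using c(2) by (intro exI[of _ 1] exI[of _ ?\<eta>] conjI order_refl) blast+
  qed
qed

end
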